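(* For $n>2$, the number of maximal chains in $\mathrm{Weak}(\mathcal{U}_n)$ is equal to twice the number of standard Young tableaux of shifted staircase shape $\Delta_n$, hence equal to $$2\binom{n}{2}!\cdot\prod_{i=0}^{n-2}\frac{i!}{(2i+1)!}.$$
   Context: A permutation $\pi\in\mathcal{S}_n$ is unimodal if either every prefix set $\{\pi(1),\dots,\pi(j)\}$, $1\le j\le n$, or every suffix set $\{\pi(j),\dots,\pi(n)\}$, $1\le j\le n$, is an interval $\{a,a+1,\dots,b\}$ in $\mathbb{Z}$. $\mathcal{U}_n$ is the set of unimodal permutations in $\mathcal{S}_n$. The (right) weak order $\mathrm{Weak}(\mathcal{S}_n)$ is defined by $\pi\le\tau$ iff $\ell(\pi)+\ell(\pi^{-1}\tau)=\ell(\tau)$, where $\ell$ is the length (number of inversions) with respect to the adjacent transpositions and products are compositions $(\pi\tau)(x)=\pi(\tau(x))$. $\mathrm{Weak}(\mathcal{U}_n)$ is the subposet of $\mathrm{Weak}(\mathcal{S}_n)$ induced by $\mathcal{U}_n$. The shifted staircase shape $\Delta_n$ is the set of boxes $(i,j)$, $1\le i<j\le n$ (row $i$, column $j$); a standard Young tableau of this shape is a filling with $1,\dots,\binom n2$, each used once, with entries increasing along each row (left to right) and each column (top to bottom). *)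

theory Defs
  imports Complex_Main "HOL-Library.FuncSet" "HOL-Combinatorics.Permutations"
begin

definition perm_length :: "nat \<Rightarrow> (nat \<Rightarrow> nat) \<Rightarrow> nat" where
  "perm_length n \<pi> = card {(i, j). 1 \<le> i \<and> i < j \<and> j \<le> n \<and> \<pi> i > \<pi> j}"

definition weak_le :: "nat \<Rightarrow> (nat \<Rightarrow> nat) \<Rightarrow> (nat \<Rightarrow> nat) \<Rightarrow> bool" where
  "weak_le n \<pi> \<tau> \<longleftrightarrow>
     perm_length n \<pi> + perm_length n (inv \<pi> \<circ> \<tau>) = perm_length n \<tau>"

definition unimodal_perms :: "nat \<Rightarrow> (nat \<Rightarrow> nat) set" where
  "unimodal_perms n = {\<pi>. \<pi> permutes {1..n} \<and>
     ((\<forall>j\<in>{1..n}. \<exists>a b. \<pi> ` {1..j} = {a..b}) \<or>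
      (\<forall>j\<in>{1..n}. \<exists>a b. \<pi> ` {j..n} = {a..b}))}"

text \<open>
  A chain is identified with its set of elements, and maximality is with respect to inclusion
  among chains of unimodal permutations. In \<^const>\<open>pred_on.maxchain\<close> the relation is replaced by
  its reflexive closure, so passing the non-strict order is harmless.
\<close>
definition maximal_chains_weak_unimodal :: "nat \<Rightarrow> (nat \<Rightarrow> nat) set set" where
  "maximal_chains_weak_unimodal n = {C. pred_on.maxchain (unimodal_perms n) (weak_le n) C}"

definition shifted_staircase :: "nat \<Rightarrow> (nat \<times> nat) set" where
  "shifted_staircase n = {(i, j). 1 \<le> i \<and> i < j \<and> j \<le> n}"

text \<open>
  Fillings are functions that are \<^const>\<open>undefined\<close> outside the shape, so that distinct functions
  are distinct fillings and counting them is meaningful.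
\<close>
definition standard_tableaux :: "(nat \<times> nat) set \<Rightarrow> (nat \<times> nat \<Rightarrow> nat) set" where
  "standard_tableaux D = {T \<in> extensional D.
     bij_betw T D {1..card D} \<and>
     (\<forall>i j k. (i, j) \<in> D \<and> (i, k) \<in> D \<and> j < k \<longrightarrow> T (i, j) < T (i, k)) \<and>
     (\<forall>i j k. (i, k) \<in> D \<and> (j, k) \<in> D \<and> i < j \<longrightarrow> T (i, k) < T (j, k))}"

text \<open>The largest entry of a filling of the shifted staircase is the number of its boxes.\<close>
lemma card_shifted_staircase: "card (shifted_staircase n) = n choose 2"
proof (induction n)
  case 0
  have "shifted_staircase 0 = {}" by (auto simp: shifted_staircase_def)
  then show ?case by simp
next
  case (Suc n)
  have eq: "shifted_staircase (Suc n) = shifted_staircase n \<union> {1..n} \<times> {Suc n}"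
    by (auto simp: shifted_staircase_def)
  have "finite (shifted_staircase n)"
    by (rule finite_subset[of _ "{..n} \<times> {..n}"]) (auto simp: shifted_staircase_def)
  then have "card (shifted_staircase (Suc n)) = card (shifted_staircase n) + n"
    unfolding eq by (subst card_Un_disjoint) (auto simp: shifted_staircase_def)
  with Suc show ?case by (simp add: numeral_2_eq_2)
qed

end

theory Submission
  imports Defs "HOL-Computational_Algebra.Polynomial"
begin

text \<open>
  The weak order is inclusion of sets of inverted pairs of values. A permutation has all prefix
  sets (suffix sets) intervals iff its inversion set is an order ideal (filter) of the staircase
  \<open>\<Delta>\<^sub>n\<close> ordered by rows and columns, and every ideal and every filter arises in this way. A
  nontrivial ideal and a nontrivial filter are never comparable, so the maximal chains are those of
  the ideals together with those of the filters; each kind is counted by the linear extensions of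
  \<open>\<Delta>\<^sub>n\<close>, which are the standard tableaux. The product formula is the case of the staircase of
  Schur's formula \<open>\<bar>\<lambda>\<bar>! \<Prod>\<^sub>i 1 / \<lambda>\<^sub>i! \<Prod>\<^sub>i\<^sub><\<^sub>j (\<lambda>\<^sub>i - \<lambda>\<^sub>j) / (\<lambda>\<^sub>i + \<lambda>\<^sub>j)\<close> for a shifted shape with row lengths
  \<open>\<lambda>\<close>, proved by removing the box with the largest entry and Lagrange interpolation.
\<close>

section \<open>Maximal chains of order ideals\<close>

text \<open>Two features of the setting shape the argument. A maximal chain is only known to admit
  no further unimodal permutation; nothing says beforehand that neighbours in it differ by one
  inversion, so that maximal chains of ideals pass through every cardinality has to be proved
  (\<open>maxchain_order_ideals_iff\<close>). And removing a box from the staircase leaves another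
  diagram, so the product formula is proved for all ideals of the staircase. For these only the set
  of row lengths matters, since nonempty rows have distinct lengths. Count and weight obey the same
  recursion: removing a corner replaces a length s by s - 1, and the interpolation identity
  contributes the sum of the lengths, that is \<open>card I\<close>, which turns the factorial of
  \<open>card I - 1\<close> into that of \<open>card I\<close>.\<close>

definition order_ideals :: "'a set \<Rightarrow> ('a \<Rightarrow> 'a \<Rightarrow> bool) \<Rightarrow> 'a set set" where
  "order_ideals D R = {I. I \<subseteq> D \<and> (\<forall>y\<in>I. \<forall>x\<in>D. R x y \<longrightarrow> x \<in> I)}"

definition linear_extensions :: "'a set \<Rightarrow> ('a \<Rightarrow> 'a \<Rightarrow> bool) \<Rightarrow> ('a \<Rightarrow> nat) set" where
  "linear_extensions D R = {T \<in> extensional D. bij_betw T D {1..card D} \<and>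
     (\<forall>x\<in>D. \<forall>y\<in>D. R x y \<longrightarrow> T x < T y)}"

text \<open>Maximality can be tested one element at a time: any element of a properly larger chain
  is already comparable with all of \<open>C\<close>.\<close>

lemma maxchain_iff:
  "pred_on.maxchain A P C \<longleftrightarrow> C \<subseteq> A \<and> (\<forall>x\<in>C. \<forall>y\<in>C. P\<^sup>=\<^sup>= x y \<or> P\<^sup>=\<^sup>= y x) \<and>
     (\<forall>z\<in>A. (\<forall>x\<in>C. P\<^sup>=\<^sup>= z x \<or> P\<^sup>=\<^sup>= x z) \<longrightarrow> z \<in> C)" (is "?L \<longleftrightarrow> ?R")
proof
  assume L: ?L
  have ch: "C \<subseteq> A" "\<forall>x\<in>C. \<forall>y\<in>C. P\<^sup>=\<^sup>= x y \<or> P\<^sup>=\<^sup>= y x"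
    using L by (auto simp: pred_on.maxchain_def pred_on.chain_def)
  moreover have "z \<in> C" if "z \<in> A" "\<forall>x\<in>C. P\<^sup>=\<^sup>= z x \<or> P\<^sup>=\<^sup>= x z" for z
  proof (rule ccontr)
    assume "z \<notin> C"
    moreover have "pred_on.chain A P (insert z C)"
      using ch that by (auto simp: pred_on.chain_def)
    ultimately show False using L unfolding pred_on.maxchain_def by blast
  qed
  ultimately show ?R by blast
next
  assume R: ?R
  then have "pred_on.chain A P C" by (auto simp: pred_on.chain_def)
  moreover have False if "pred_on.chain A P S" "C \<subset> S" for S
  proof -
    from that obtain z where "z \<in> S" "z \<notin> C" by blast
    moreover have "S \<subseteq> A" "\<forall>x\<in>S. \<forall>y\<in>S. P\<^sup>=\<^sup>= x y \<or> P\<^sup>=\<^sup>= y x"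
      using that by (simp_all add: pred_on.chain_def)
    ultimately have "z \<in> A" "\<forall>x\<in>C. P\<^sup>=\<^sup>= z x \<or> P\<^sup>=\<^sup>= x z" using that(2) by blast+
    then show False using R \<open>z \<notin> C\<close> by blast
  qed
  ultimately show ?L unfolding pred_on.maxchain_def by blast
qed

text \<open>Chains see only comparability, not its direction. The hypothesis is therefore symmetric,
  and the lemma serves both the order isomorphism \<open>value_inversions\<close> and the
  order-reversing complementation of ideals.\<close>

lemma bij_betw_maxchain_image:
  assumes inj: "inj_on f A"
    and iff: "\<And>x y. x \<in> A \<Longrightarrow> y \<in> A \<Longrightarrow> P x y \<or> P y x \<longleftrightarrow> Q (f x) (f y) \<or> Q (f y) (f x)"
  shows "bij_betw ((`) f) {C. pred_on.maxchain A P C} {C. pred_on.maxchain (f ` A) Q C}"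
proof (rule bij_betw_imageI)
  show "inj_on ((`) f) {C. pred_on.maxchain A P C}"
  proof (rule inj_onI)
    fix C C' assume "C \<in> {C. pred_on.maxchain A P C}" "C' \<in> {C. pred_on.maxchain A P C}"
    then have "C \<subseteq> A" "C' \<subseteq> A" by (simp_all add: maxchain_iff)
    then show "f ` C = f ` C' \<Longrightarrow> C = C'" using inj_on_image_eq_iff[OF inj] by blast
  qed
  have iff': "P\<^sup>=\<^sup>= x y \<or> P\<^sup>=\<^sup>= y x \<longleftrightarrow> Q\<^sup>=\<^sup>= (f x) (f y) \<or> Q\<^sup>=\<^sup>= (f y) (f x)"
    if "x \<in> A" "y \<in> A" for x y
    using iff[OF that] inj_on_eq_iff[OF inj that] by auto
  have key: "pred_on.maxchain (f ` A) Q (f ` C) \<longleftrightarrow> pred_on.maxchain A P C" if "C \<subseteq> A" for C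
  proof -
    have "f z \<in> f ` C \<longleftrightarrow> z \<in> C" if "z \<in> A" for z
      using inj \<open>C \<subseteq> A\<close> that by (meson inj_on_image_mem_iff)
    moreover have "(\<forall>x\<in>C. \<forall>y\<in>C. P\<^sup>=\<^sup>= x y \<or> P\<^sup>=\<^sup>= y x) \<longleftrightarrow>
        (\<forall>x\<in>C. \<forall>y\<in>C. Q\<^sup>=\<^sup>= (f x) (f y) \<or> Q\<^sup>=\<^sup>= (f y) (f x))"
      using iff' that by (meson subsetD)
    moreover have "(\<forall>x\<in>C. P\<^sup>=\<^sup>= z x \<or> P\<^sup>=\<^sup>= x z) \<longleftrightarrow> (\<forall>x\<in>C. Q\<^sup>=\<^sup>= (f z) (f x) \<or> Q\<^sup>=\<^sup>= (f x) (f z))"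
      if "z \<in> A" for z
      using iff' that \<open>C \<subseteq> A\<close> by (meson subsetD)
    ultimately show ?thesis
      unfolding maxchain_iff ball_simps using that by (simp add: image_mono)
  qed
  show "(`) f ` {C. pred_on.maxchain A P C} = {C. pred_on.maxchain (f ` A) Q C}"
  proof (intro equalityI subsetI)
    fix C assume "C \<in> (`) f ` {C. pred_on.maxchain A P C}"
    then show "C \<in> {C. pred_on.maxchain (f ` A) Q C}"
      using key by (auto simp: maxchain_iff[of A])
  next
    fix C assume C: "C \<in> {C. pred_on.maxchain (f ` A) Q C}"
    then have "C \<subseteq> f ` A" by (simp add: maxchain_iff)
    then obtain C' where "C' \<subseteq> A" "C = f ` C'" by (meson subset_imageE)
    then show "C \<in> (`) f ` {C. pred_on.maxchain A P C}" using C key by auto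
  qed
qed

text \<open>Elements outside the intersection are never comparable across the two sets, so a chain
  stays in one of them. It cannot be maximal in both: inside the intersection it could be extended
  by any element of \<open>A - B\<close>, because common elements are comparable with
  everything.\<close>

lemma card_maxchain_Un:
  assumes fin: "finite A" "finite B"
    and cmp: "\<And>k x. k \<in> A \<inter> B \<Longrightarrow> x \<in> A \<union> B \<Longrightarrow> P\<^sup>=\<^sup>= k x \<or> P\<^sup>=\<^sup>= x k"
    and incmp: "\<And>a b. a \<in> A - B \<Longrightarrow> b \<in> B - A \<Longrightarrow> \<not> P a b \<and> \<not> P b a"
    and ne: "\<not> A \<subseteq> B" "\<not> B \<subseteq> A"
  shows "card {C. pred_on.maxchain (A \<union> B) P C} =
    card {C. pred_on.maxchain A P C} + card {C. pred_on.maxchain B P C}"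
proof -
  have outA: "\<not> C \<subseteq> B" if C: "pred_on.maxchain A P C" for C
  proof
    assume "C \<subseteq> B"
    obtain a where a: "a \<in> A" "a \<notin> B" using ne by blast
    have "P\<^sup>=\<^sup>= a x \<or> P\<^sup>=\<^sup>= x a" if "x \<in> C" for x
      using cmp[of x a] a that C \<open>C \<subseteq> B\<close> by (auto simp: maxchain_iff)
    then have "a \<in> C" using C a unfolding maxchain_iff by blast
    then show False using \<open>C \<subseteq> B\<close> a by blast
  qed
  have outB: "\<not> C \<subseteq> A" if C: "pred_on.maxchain B P C" for C
  proof
    assume "C \<subseteq> A"
    obtain a where a: "a \<in> B" "a \<notin> A" using ne by blast
    have "P\<^sup>=\<^sup>= a x \<or> P\<^sup>=\<^sup>= x a" if "x \<in> C" for x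
      using cmp[of x a] a that C \<open>C \<subseteq> A\<close> by (auto simp: maxchain_iff)
    then have "a \<in> C" using C a unfolding maxchain_iff by blast
    then show False using \<open>C \<subseteq> A\<close> a by blast
  qed
  have eq: "{C. pred_on.maxchain (A \<union> B) P C} =
      {C. pred_on.maxchain A P C} \<union> {C. pred_on.maxchain B P C}"
  proof (intro equalityI subsetI)
    fix C assume "C \<in> {C. pred_on.maxchain (A \<union> B) P C}"
    then have C: "pred_on.maxchain (A \<union> B) P C" by simp
    have "C \<subseteq> A \<or> C \<subseteq> B"
    proof (rule ccontr)
      assume "\<not> (C \<subseteq> A \<or> C \<subseteq> B)"
      moreover have "C \<subseteq> A \<union> B" using C by (simp add: maxchain_iff)
      ultimately obtain a b where "a \<in> C" "a \<in> A - B" "b \<in> C" "b \<in> B - A" by blast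
      moreover then have "P\<^sup>=\<^sup>= a b \<or> P\<^sup>=\<^sup>= b a" using C unfolding maxchain_iff by blast
      ultimately show False using incmp[of a b] by auto
    qed
    then show "C \<in> {C. pred_on.maxchain A P C} \<union> {C. pred_on.maxchain B P C}"
      using C unfolding maxchain_iff by blast
  next
    fix C assume "C \<in> {C. pred_on.maxchain A P C} \<union> {C. pred_on.maxchain B P C}"
    then show "C \<in> {C. pred_on.maxchain (A \<union> B) P C}"
    proof
      assume "C \<in> {C. pred_on.maxchain A P C}"
      then have C: "pred_on.maxchain A P C" by simp
      then obtain a where a: "a \<in> C" "a \<in> A - B" using outA[OF C] unfolding maxchain_iff by blast
      \<comment> \<open>A candidate from \<open>B - A\<close> would be incomparable with
        \<open>a\<close>, so maximality within \<open>A\<close> already gives maximality within the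
        union.\<close>
      have "z \<in> A" if "z \<in> A \<union> B" "\<forall>x\<in>C. P\<^sup>=\<^sup>= z x \<or> P\<^sup>=\<^sup>= x z" for z
        using that a incmp[of a z] by auto
      then show ?thesis using C unfolding maxchain_iff by blast
    next
      assume "C \<in> {C. pred_on.maxchain B P C}"
      then have C: "pred_on.maxchain B P C" by simp
      then obtain b where b: "b \<in> C" "b \<in> B - A" using outB[OF C] unfolding maxchain_iff by blast
      have "z \<in> B" if "z \<in> A \<union> B" "\<forall>x\<in>C. P\<^sup>=\<^sup>= z x \<or> P\<^sup>=\<^sup>= x z" for z
        using that b incmp[of z b] by auto
      then show ?thesis using C unfolding maxchain_iff by blast
    qed
  qed
  have finC: "finite {C. pred_on.maxchain X P C}" if "finite X" for X
    by (rule finite_subset[of _ "Pow X"]) (use that in \<open>auto simp: maxchain_iff\<close>)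
  show ?thesis unfolding eq
    by (rule card_Un_disjoint) (use fin finC outA maxchain_iff[of B] in auto)
qed

text \<open>A chain with a member of every size is maximal because an ideal comparable with a member
  of its own size equals it. The converse fills gaps by adding one element at a time; the rank
  \<open>r\<close> supplies minimal elements even when \<open>R\<close> is not transitive.\<close>

lemma maxchain_order_ideals_iff:
  fixes r :: "'a \<Rightarrow> nat"
  assumes fin: "finite D" and rank: "\<And>x y. R x y \<Longrightarrow> r x < r y"
  shows "pred_on.maxchain (order_ideals D R) (\<subseteq>) C \<longleftrightarrow>
    C \<subseteq> order_ideals D R \<and> (\<forall>I\<in>C. \<forall>J\<in>C. I \<subseteq> J \<or> J \<subseteq> I) \<and> (\<forall>k\<le>card D. \<exists>I\<in>C. card I = k)"
    (is "?L \<longleftrightarrow> ?S \<and> ?cmp \<and> ?hit")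
proof
  assume L: ?L
  have S: ?S and cmp: ?cmp using L by (auto simp: maxchain_iff)
  have mx: "I \<in> C" if "I \<in> order_ideals D R" "\<And>J. J \<in> C \<Longrightarrow> I \<subseteq> J \<or> J \<subseteq> I" for I
    using L that unfolding maxchain_iff by auto
  have sub: "I \<subseteq> D" if "I \<in> C" for I using S that by (auto simp: order_ideals_def)
  have finI: "finite I" if "I \<in> C" for I using sub[OF that] fin finite_subset by blast
  have top: "D \<in> C" by (rule mx) (use sub in \<open>auto simp: order_ideals_def\<close>)
  have bot: "{} \<in> C" by (rule mx) (auto simp: order_ideals_def)
  have le: "I \<subseteq> J" if "I \<in> C" "J \<in> C" "card I \<le> card J" for I J
    using cmp that finI by (metis card_seteq order_refl)
  have "\<exists>I\<in>C. card I = k" if "k \<le> card D" for k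
  proof (cases "k = 0")
    case True
    then show ?thesis using bot by (auto intro!: bexI[of _ "{}"])
  next
    case False
    \<comment> \<open>\<open>J\<close> is the smallest member with at least \<open>k\<close>
      elements and \<open>I\<close> the largest with fewer. An \<open>r\<close>-minimal element of
      \<open>J - I\<close> can be added to \<open>I\<close>, giving an ideal between the two; by
      maximality it belongs to \<open>C\<close>, and this forces its size to be
      \<open>k\<close>.\<close>
    have "\<exists>J. (J \<in> C \<and> k \<le> card J) \<and> (\<forall>K. K \<in> C \<and> k \<le> card K \<longrightarrow> card J \<le> card K)"
      by (rule ex_has_least_nat[of _ D]) (use top that in simp)
    then obtain J where J: "J \<in> C" "k \<le> card J"
      "\<And>K. K \<in> C \<Longrightarrow> k \<le> card K \<Longrightarrow> card J \<le> card K" by blast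
    have "\<exists>I. (I \<in> C \<and> card I < k) \<and> (\<forall>K. K \<in> C \<and> card K < k \<longrightarrow> card K \<le> card I)"
      by (rule ex_has_greatest_nat[of _ "{}" _ k]) (use bot False in auto)
    then obtain I where I: "I \<in> C" "card I < k"
      "\<And>K. K \<in> C \<Longrightarrow> card K < k \<Longrightarrow> card K \<le> card I" by blast
    have "I \<subseteq> J" using le I(1,2) J(1,2) by simp
    moreover have "I \<noteq> J" using I(2) J(2) by auto
    ultimately have "J - I \<noteq> {}" by blast
    then obtain x where x: "x \<in> J - I" "\<And>y. r y < r x \<Longrightarrow> y \<notin> J - I"
      using ex_has_least_nat[of "\<lambda>x. x \<in> J - I" _ r] by (metis ex_in_conv not_le)
    \<comment> \<open>Anything \<open>R\<close>-below \<open>x\<close> lies in the ideal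
      \<open>J\<close> and has smaller rank, hence lies in \<open>I\<close> by the choice of
      \<open>x\<close>.\<close>
    have ideal: "insert x I \<in> order_ideals D R"
      using S I(1) J(1) x rank unfolding order_ideals_def by fastforce
    have card: "card (insert x I) = Suc (card I)" using x finI[OF I(1)] by simp
    have "insert x I \<in> C"
    proof (rule mx[OF ideal])
      fix K assume K: "K \<in> C"
      show "insert x I \<subseteq> K \<or> K \<subseteq> insert x I"
      proof (cases "card K < k")
        case True
        then show ?thesis using le[OF K I(1)] I(3)[OF K] by blast
      next
        case False
        then show ?thesis using le[OF J(1) K] J(3)[OF K] x \<open>I \<subseteq> J\<close> by auto
      qed
    qed
    moreover from this have "card (insert x I) = k" using I(2,3) card by fastforce
    ultimately show ?thesis by blast
  qed
  then show "?S \<and> ?cmp \<and> ?hit" using S cmp by blast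
next
  assume R: "?S \<and> ?cmp \<and> ?hit"
  have "z \<in> C" if z: "z \<in> order_ideals D R" "\<forall>x\<in>C. z \<subseteq> x \<or> x \<subseteq> z" for z
  proof -
    have "z \<subseteq> D" using z by (simp add: order_ideals_def)
    then obtain I where "I \<in> C" "card I = card z" using R fin by (meson card_mono)
    moreover from this have "I \<subseteq> D" using R by (auto simp: order_ideals_def)
    ultimately show ?thesis using z(2) fin \<open>z \<subseteq> D\<close>
      by (metis card_subset_eq finite_subset)
  qed
  then show ?L using R unfolding maxchain_iff by auto
qed

text \<open>A linear extension corresponds to the maximal chain of its sublevel sets.\<close>
lemma card_maxchain_order_ideals:
  fixes r :: "'a \<Rightarrow> nat"
  assumes fin: "finite D" and rank: "\<And>x y. R x y \<Longrightarrow> r x < r y"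
  shows "card {C. pred_on.maxchain (order_ideals D R) (\<subseteq>) C} = card (linear_extensions D R)"
proof -
  have iff: "pred_on.maxchain (order_ideals D R) (\<subseteq>) C \<longleftrightarrow> C \<subseteq> order_ideals D R \<and>
      (\<forall>I\<in>C. \<forall>J\<in>C. I \<subseteq> J \<or> J \<subseteq> I) \<and> (\<forall>k\<le>card D. \<exists>I\<in>C. card I = k)" for C
    by (rule maxchain_order_ideals_iff[OF fin]) (rule rank)
  let ?lev = "\<lambda>T k. {x \<in> D. T x \<le> (k::nat)}"
  let ?F = "\<lambda>T. ?lev T ` {..card D}"
  have card_lev: "card (?lev T k) = k" if T: "T \<in> linear_extensions D R" and k: "k \<le> card D" for T k
  proof -
    have bij: "bij_betw T D {1..card D}" using T by (simp add: linear_extensions_def)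
    have "T ` ?lev T k = {1..k}"
    proof (intro equalityI subsetI)
      fix l assume "l \<in> {1..k}"
      moreover then obtain x where "x \<in> D" "T x = l"
        using bij k unfolding bij_betw_def by (metis atLeastAtMost_iff imageE order_trans)
      ultimately show "l \<in> T ` ?lev T k" by auto
    qed (use bij bij_betwE in fastforce)
    moreover have "inj_on T (?lev T k)" using bij by (auto simp: bij_betw_def intro: inj_on_subset)
    ultimately show ?thesis by (metis card_atLeastAtMost card_image diff_Suc_1)
  qed
  have "bij_betw ?F (linear_extensions D R) {C. pred_on.maxchain (order_ideals D R) (\<subseteq>) C}"
  proof (rule bij_betw_imageI)
    show "inj_on ?F (linear_extensions D R)"
    proof (rule inj_onI)
      fix T T' assume T: "T \<in> linear_extensions D R" and T': "T' \<in> linear_extensions D R"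
        and eq: "?F T = ?F T'"
      have lev: "?lev T k = ?lev T' k" if "k \<le> card D" for k
      proof -
        have "?lev T k \<in> ?F T'" using eq that by blast
        then obtain l where "l \<le> card D" "?lev T k = ?lev T' l" by auto
        then show ?thesis using card_lev[OF T that] card_lev[OF T' \<open>l \<le> card D\<close>] by auto
      qed
      have "T x = T' x" for x
      proof (cases "x \<in> D")
        case True
        then have "T x \<le> card D" "T' x \<le> card D"
          using T T' by (auto simp: linear_extensions_def dest: bij_betwE)
        moreover from this have "x \<in> ?lev T' (T x)" "x \<in> ?lev T (T' x)"
          using lev True by blast+
        ultimately show ?thesis by auto
      next
        case False
        then show ?thesis using T T' by (simp add: linear_extensions_def extensional_def)
      qed
      then show "T = T'" by blast
    qed
    show "?F ` linear_extensions D R = {C. pred_on.maxchain (order_ideals D R) (\<subseteq>) C}"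
    proof (intro equalityI subsetI)
      fix C assume "C \<in> ?F ` linear_extensions D R"
      then obtain T where T: "T \<in> linear_extensions D R" and C: "C = ?F T" by blast
      have "?lev T k \<in> order_ideals D R" for k
        using T by (fastforce simp: order_ideals_def linear_extensions_def)
      moreover have "?lev T k \<subseteq> ?lev T l \<or> ?lev T l \<subseteq> ?lev T k" for k l
        using nat_le_linear[of k l] by fastforce
      ultimately show "C \<in> {C. pred_on.maxchain (order_ideals D R) (\<subseteq>) C}"
        using card_lev[OF T] unfolding mem_Collect_eq iff C by blast
    next
      fix C assume "C \<in> {C. pred_on.maxchain (order_ideals D R) (\<subseteq>) C}"
      then have S: "C \<subseteq> order_ideals D R" and cmp: "\<forall>I\<in>C. \<forall>J\<in>C. I \<subseteq> J \<or> J \<subseteq> I"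
        and hit: "\<forall>k\<le>card D. \<exists>I\<in>C. card I = k" by (simp_all add: iff)
      have sub: "I \<subseteq> D" if "I \<in> C" for I using S that by (auto simp: order_ideals_def)
      have finI: "finite I" if "I \<in> C" for I using sub[OF that] fin finite_subset by blast
      have le: "I \<subseteq> J" if "I \<in> C" "J \<in> C" "card I \<le> card J" for I J
        using cmp that finI by (metis card_seteq order_refl)
      \<comment> \<open>\<open>T x\<close> is the size of the smallest member of the chain
        containing \<open>x\<close>; the members then become the sublevel sets of
        \<open>T\<close>.\<close>
      define T where "T x = (if x \<in> D then LEAST k. \<exists>I\<in>C. card I = k \<and> x \<in> I else undefined)" for x
      have topC: "D \<in> C" using hit sub fin by (metis card_subset_eq order_refl)
      have T_le: "T x \<le> card I \<longleftrightarrow> x \<in> I" if "I \<in> C" "x \<in> D" for I x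
      proof
        assume *: "T x \<le> card I"
        have "\<exists>J\<in>C. card J = T x \<and> x \<in> J"
        proof -
          have "\<exists>J\<in>C. card J = card D \<and> x \<in> J" using that topC by blast
          from LeastI[of "\<lambda>k. \<exists>I\<in>C. card I = k \<and> x \<in> I", OF this]
          show ?thesis unfolding T_def if_P[OF that(2)] .
        qed
        then obtain J where "J \<in> C" "card J = T x" "x \<in> J" by blast
        then show "x \<in> I" using * le[of J I] that(1) by auto
      next
        assume "x \<in> I"
        then show "T x \<le> card I" using that unfolding T_def by (auto intro: Least_le)
      qed
      \<comment> \<open>The element by which the member of size \<open>k\<close> exceeds the member
        of size \<open>k - 1\<close> receives the value \<open>k\<close>.\<close>
      have surj: "{1..card D} \<subseteq> T ` D"
      proof
        fix k assume k: "k \<in> {1..card D}"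
        then obtain I where I: "I \<in> C" "card I = k" using hit by auto
        obtain J where J: "J \<in> C" "card J = k - 1" using hit k
          by (metis One_nat_def atLeastAtMost_iff diff_le_self order_trans)
        have "\<not> I \<subseteq> J" using I J k card_mono[OF finI[OF J(1)], of I] by auto
        then obtain x where x: "x \<in> I" "x \<notin> J" by blast
        moreover have "x \<in> D" using x I sub by blast
        ultimately have "T x = k" using T_le[OF I(1), of x] T_le[OF J(1), of x] I J by auto
        then show "k \<in> T ` D" using \<open>x \<in> D\<close> by blast
      qed
      have Tpos: "T x \<ge> 1" if "x \<in> D" for x
      proof -
        obtain I where I: "I \<in> C" "card I = 0" using hit by blast
        then have "I = {}" using finI by auto
        then show ?thesis using T_le[OF I(1) that] I(2) by auto
      qed
      have "T ` D \<subseteq> {1..card D}" using Tpos T_le[OF topC] by auto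
      with surj have im: "T ` D = {1..card D}" by blast
      then have inj: "inj_on T D" by (intro eq_card_imp_inj_on[OF fin]) simp
      have mono: "T x < T y" if "x \<in> D" "y \<in> D" "R x y" for x y
      proof -
        have "T y \<le> card D" using T_le[OF topC] that by blast
        then obtain I where I: "I \<in> C" "card I = T y" using hit by blast
        then have "y \<in> I" using T_le[OF I(1) that(2)] by simp
        then have "x \<in> I" using I S that by (auto simp: order_ideals_def)
        then have "T x \<le> T y" using T_le[OF I(1) that(1)] I(2) by simp
        moreover have "T x \<noteq> T y" using inj_onD[OF inj _ that(1,2)] rank[OF that(3)] by auto
        ultimately show ?thesis by simp
      qed
      have T: "T \<in> linear_extensions D R"
        using im inj mono unfolding linear_extensions_def bij_betw_def by (simp add: T_def extensional_def)
      have lev: "?lev T (card I) = I" if "I \<in> C" for I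
        using T_le[OF that] sub[OF that] by blast
      have "C = ?F T"
      proof (intro equalityI subsetI)
        fix I assume "I \<in> C"
        then show "I \<in> ?F T"
          using card_mono[OF fin sub] by (intro image_eqI[of _ _ "card I"]) (simp_all add: lev)
      next
        fix I assume "I \<in> ?F T"
        then obtain k where "k \<le> card D" "I = ?lev T k" by auto
        moreover from this obtain J where "J \<in> C" "card J = k" using hit by blast
        ultimately show "I \<in> C" using lev by metis
      qed
      then show "C \<in> ?F ` linear_extensions D R" using T by blast
    qed
  qed
  then show ?thesis by (simp add: bij_betw_same_card)
qed

section \<open>Counting linear extensions by the place of the largest value\<close>

lemma finite_linear_extensions:
  assumes "finite D"
  shows "finite (linear_extensions D R)"
proof (rule finite_subset)
  show "linear_extensions D R \<subseteq> D \<rightarrow>\<^sub>E {1..card D}"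
  proof
    fix T assume T: "T \<in> linear_extensions D R"
    then have "T x \<in> {1..card D}" if "x \<in> D" for x
      using that bij_betwE by (fastforce simp: linear_extensions_def)
    then show "T \<in> D \<rightarrow>\<^sub>E {1..card D}" using T by (auto simp: linear_extensions_def PiE_iff)
  qed
  show "finite (D \<rightarrow>\<^sub>E {1..card D})" using assms by (simp add: finite_PiE)
qed

text \<open>The largest value \<open>card D\<close> can only sit at an element with nothing above
  it; for a fixed such element, deleting it is a bijection onto the linear extensions of the
  rest.\<close>

lemma card_linear_extensions_rec:
  assumes fin: "finite D" and ne: "D \<noteq> {}" and irr: "\<And>x. \<not> R x x"
  shows "card (linear_extensions D R) =
    (\<Sum>x | x \<in> D \<and> (\<forall>y\<in>D. \<not> R x y). card (linear_extensions (D - {x}) R))"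
proof -
  let ?M = "{x \<in> D. \<forall>y\<in>D. \<not> R x y}"
  let ?L = "\<lambda>x. {T \<in> linear_extensions D R. T x = card D}"
  have pos: "card D > 0" using fin ne by (simp add: card_gt_0_iff)
  have eq: "linear_extensions D R = (\<Union>x\<in>?M. ?L x)"
  proof (intro equalityI subsetI)
    fix T assume T: "T \<in> linear_extensions D R"
    then have bij: "bij_betw T D {1..card D}" by (simp add: linear_extensions_def)
    then obtain x where x: "x \<in> D" "T x = card D"
      using pos unfolding bij_betw_def by (metis One_nat_def Suc_leI atLeastAtMost_iff imageE order_refl)
    have "\<not> R x y" if "y \<in> D" for y
      using T x that bij_betwE[OF bij] unfolding linear_extensions_def
      by (metis (mono_tags, lifting) atLeastAtMost_iff mem_Collect_eq not_less)
    then show "T \<in> (\<Union>x\<in>?M. ?L x)" using x T by blast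
  qed auto
  have "card (\<Union>x\<in>?M. ?L x) = (\<Sum>x\<in>?M. card (?L x))"
  proof (rule card_UN_disjoint)
    show "\<forall>x\<in>?M. \<forall>y\<in>?M. x \<noteq> y \<longrightarrow> ?L x \<inter> ?L y = {}"
    proof (intro ballI impI equals0I)
      fix x y T assume *: "x \<in> ?M" "y \<in> ?M" "x \<noteq> y" "T \<in> ?L x \<inter> ?L y"
      then have "inj_on T D" by (simp add: linear_extensions_def bij_betw_def)
      then show False using * inj_onD[of T D x y] by auto
    qed
  qed (use fin finite_linear_extensions[OF fin, of R] in auto)
  also have "\<dots> = (\<Sum>x\<in>?M. card (linear_extensions (D - {x}) R))"
  proof (rule sum.cong[OF refl])
    fix x assume x: "x \<in> ?M"
    then have cD: "card D = Suc (card (D - {x}))" using fin by (metis card.remove mem_Collect_eq)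
    have "bij_betw (\<lambda>T. restrict T (D - {x})) (?L x) (linear_extensions (D - {x}) R)"
    proof (rule bij_betw_byWitness[where f' = "\<lambda>T. T(x := card D)"])
      show "\<forall>T\<in>?L x. (restrict T (D - {x}))(x := card D) = T"
        using x by (auto simp: linear_extensions_def extensional_def fun_eq_iff)
      show "\<forall>T\<in>linear_extensions (D - {x}) R. restrict (T(x := card D)) (D - {x}) = T"
        by (auto simp: linear_extensions_def extensional_def fun_eq_iff)
      show "(\<lambda>T. restrict T (D - {x})) ` ?L x \<subseteq> linear_extensions (D - {x}) R"
      proof (rule image_subsetI)
        fix T assume T: "T \<in> ?L x"
        then have "bij_betw T (D - {x}) ({1..card D} - {T x})"
          using x pos by (intro bij_betw_DiffI) (auto simp: linear_extensions_def)
        moreover have "{1..card D} - {T x} = {1..card (D - {x})}" using T cD by auto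
        ultimately have "bij_betw (restrict T (D - {x})) (D - {x}) {1..card (D - {x})}"
          by (metis bij_betw_cong restrict_apply')
        then show "restrict T (D - {x}) \<in> linear_extensions (D - {x}) R"
          using T by (auto simp: linear_extensions_def)
      qed
      show "(\<lambda>T. T(x := card D)) ` linear_extensions (D - {x}) R \<subseteq> ?L x"
      proof (rule image_subsetI)
        fix T assume T: "T \<in> linear_extensions (D - {x}) R"
        then have b: "bij_betw T (D - {x}) {1..card (D - {x})}" by (simp add: linear_extensions_def)
        then have "bij_betw (T(x := card D)) (D - {x}) {1..card (D - {x})}"
          by (subst bij_betw_cong[of _ _ T]) auto
        then have "bij_betw (T(x := card D)) (insert x (D - {x})) (insert (card D) {1..card (D - {x})})"
          using cD notIn_Un_bij_betw[of x "D - {x}" "T(x := card D)" "{1..card (D - {x})}"] by simp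
        moreover have "insert x (D - {x}) = D" using x by auto
        moreover have "insert (card D) {1..card (D - {x})} = {1..card D}" using cD by auto
        ultimately have "bij_betw (T(x := card D)) D {1..card D}" by simp
        moreover have "(T(x := card D)) y < (T(x := card D)) z" if "y \<in> D" "z \<in> D" "R y z" for y z
        proof -
          have "y \<noteq> x" using that x by auto
          then have "T y \<le> card (D - {x})" using b that bij_betwE by fastforce
          then show ?thesis using that T \<open>y \<noteq> x\<close> cD by (auto simp: linear_extensions_def)
        qed
        ultimately show "T(x := card D) \<in> ?L x"
          using T x by (simp add: linear_extensions_def extensional_def)
      qed
    qed
    then show "card (?L x) = card (linear_extensions (D - {x}) R)" by (rule bij_betw_same_card)
  qed
  finally show ?thesis using eq by simp
qed

section \<open>Inversion sets of unimodal permutations\<close>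

text \<open>Pairs are recorded by value, the larger value standing earlier in one-line notation.
  Going up in the right weak order permutes positions, so inverted pairs of values persist while
  inverted pairs of positions need not.\<close>

definition value_inversions :: "nat \<Rightarrow> (nat \<Rightarrow> nat) \<Rightarrow> (nat \<times> nat) set" where
  "value_inversions n \<pi> = {(a, b) \<in> shifted_staircase n. inv \<pi> b < inv \<pi> a}"

lemma mem_value_inversions:
  "(a, b) \<in> value_inversions n \<pi> \<longleftrightarrow> 1 \<le> a \<and> a < b \<and> b \<le> n \<and> inv \<pi> b < inv \<pi> a"
  by (auto simp: value_inversions_def shifted_staircase_def)

lemma finite_shifted_staircase: "finite (shifted_staircase n)"
  by (rule finite_subset[of _ "{..n} \<times> {..n}"]) (auto simp: shifted_staircase_def)

lemma finite_value_inversions: "finite (value_inversions n \<pi>)"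
  by (rule finite_subset[OF _ finite_shifted_staircase]) (auto simp: value_inversions_def)

lemma permutes_inv_atLeastAtMost:
  assumes "\<pi> permutes {1..n::nat}"
  shows "x \<in> {1..n} \<Longrightarrow> inv \<pi> x \<in> {1..n}" and "inv \<pi> x = inv \<pi> y \<longleftrightarrow> x = y"
  using permutes_in_image[OF permutes_inv[OF assms], of x]
    inj_eq[OF permutes_inj[OF permutes_inv[OF assms]], of x y] by blast+

text \<open>For positions i < j the value \<open>\<tau> i\<close> precedes \<open>\<tau> j\<close>
  in \<open>\<tau>\<close>; the composition inverts (i, j) exactly when \<open>\<pi>\<close> lists
  these two values in the other order. Sorting the two values by \<open>min\<close> and
  \<open>max\<close> gives the pair on which the inversion sets disagree.\<close>

lemma perm_length_inv_comp:
  assumes \<pi>: "\<pi> permutes {1..n}" and \<tau>: "\<tau> permutes {1..n}"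
  shows "perm_length n (inv \<pi> \<circ> \<tau>) = card (sym_diff (value_inversions n \<pi>) (value_inversions n \<tau>))"
proof -
  have mem: "\<tau> i \<in> {1..n} \<longleftrightarrow> i \<in> {1..n}" "inv \<tau> i \<in> {1..n} \<longleftrightarrow> i \<in> {1..n}" for i
    by (rule permutes_in_image[OF \<tau>], rule permutes_in_image[OF permutes_inv[OF \<tau>]])
  have cancel: "\<tau> (inv \<tau> i) = i" "inv \<tau> (\<tau> i) = i" for i
    using \<tau> by (simp_all add: permutes_inverses)
  have inj: "\<tau> i = \<tau> j \<longleftrightarrow> i = j" "inv \<tau> i = inv \<tau> j \<longleftrightarrow> i = j" "inv \<pi> i = inv \<pi> j \<longleftrightarrow> i = j" for i j
    using cancel permutes_inv_atLeastAtMost(2)[OF \<pi>] by metis+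
  let ?A = "{(i, j). 1 \<le> i \<and> i < j \<and> j \<le> n \<and> (inv \<pi> \<circ> \<tau>) i > (inv \<pi> \<circ> \<tau>) j}"
  let ?B = "sym_diff (value_inversions n \<pi>) (value_inversions n \<tau>)"
  let ?f = "\<lambda>(i, j). (min (\<tau> i) (\<tau> j), max (\<tau> i) (\<tau> j))"
  let ?g = "\<lambda>(a, b). (min (inv \<tau> a) (inv \<tau> b), max (inv \<tau> a) (inv \<tau> b))"
  have memB: "(a, b) \<in> ?B \<longleftrightarrow> 1 \<le> a \<and> a < b \<and> b \<le> n \<and>
      (inv \<pi> b < inv \<pi> a \<longleftrightarrow> \<not> inv \<tau> b < inv \<tau> a)" for a b
    by (auto simp: mem_value_inversions)
  have "bij_betw ?f ?A ?B"
  proof (rule bij_betw_byWitness[where f' = ?g])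
    show "\<forall>x\<in>?A. ?g (?f x) = x"
    proof
      fix x assume "x \<in> ?A"
      then obtain i j where "x = (i, j)" "i < j" by blast
      then show "?g (?f x) = x"
        by (cases "\<tau> i < \<tau> j") (auto simp: min_def max_def cancel)
    qed
    show "\<forall>y\<in>?B. ?f (?g y) = y"
    proof
      fix y assume "y \<in> ?B"
      then obtain a b where "y = (a, b)" "a < b" using memB by (metis prod.exhaust)
      then show "?f (?g y) = y"
        by (cases "inv \<tau> a < inv \<tau> b") (auto simp: min_def max_def cancel)
    qed
    show "?f ` ?A \<subseteq> ?B"
    proof (rule image_subsetI)
      fix x assume "x \<in> ?A"
      then obtain i j where x: "x = (i, j)"
        and ij: "1 \<le> i" "i < j" "j \<le> n" "inv \<pi> (\<tau> j) < inv \<pi> (\<tau> i)" by auto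
      then have "i \<in> {1..n}" "j \<in> {1..n}" "i \<noteq> j" by auto
      then have "\<tau> i \<in> {1..n}" "\<tau> j \<in> {1..n}" "\<tau> i \<noteq> \<tau> j" by (simp_all only: mem inj not_False_eq_True)
      then show "?f x \<in> ?B"
        using ij unfolding x case_prod_conv memB
        by (cases "\<tau> i < \<tau> j") (auto simp: min_def max_def cancel)
    qed
    show "?g ` ?B \<subseteq> ?A"
    proof (rule image_subsetI)
      fix y assume "y \<in> ?B"
      then obtain a b where y: "y = (a, b)" and "(a, b) \<in> ?B" by (metis prod.exhaust)
      then have ab: "1 \<le> a" "a < b" "b \<le> n" "inv \<pi> b < inv \<pi> a \<longleftrightarrow> \<not> inv \<tau> b < inv \<tau> a"
        unfolding memB by blast+
      then have "a \<in> {1..n}" "b \<in> {1..n}" "a \<noteq> b" by auto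
      then have "inv \<tau> a \<in> {1..n}" "inv \<tau> b \<in> {1..n}" "inv \<tau> a \<noteq> inv \<tau> b" "inv \<pi> a \<noteq> inv \<pi> b"
        by (simp_all only: mem inj not_False_eq_True)
      then show "?g y \<in> ?A" unfolding y
        using ab by (cases "inv \<tau> a < inv \<tau> b") (auto simp: min_def max_def cancel)
    qed
  qed
  then show ?thesis unfolding perm_length_def by (rule bij_betw_same_card)
qed

lemma perm_length_eq_card_value_inversions:
  assumes "\<pi> permutes {1..n}"
  shows "perm_length n \<pi> = card (value_inversions n \<pi>)"
proof -
  have "value_inversions n id = {}" by (auto simp: value_inversions_def shifted_staircase_def)
  then show ?thesis using perm_length_inv_comp[OF permutes_id assms] by (simp add: inv_id)
qed

text \<open>Splitting both inversion sets along their intersection, the length equation collapses to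
  the vanishing of twice the cardinality of \<open>?P - ?T\<close>.\<close>

lemma weak_le_iff_value_inversions:
  assumes "\<pi> permutes {1..n}" "\<tau> permutes {1..n}"
  shows "weak_le n \<pi> \<tau> \<longleftrightarrow> value_inversions n \<pi> \<subseteq> value_inversions n \<tau>"
proof -
  let ?P = "value_inversions n \<pi>" and ?T = "value_inversions n \<tau>"
  have fin: "finite ?P" "finite ?T" by (simp_all add: finite_value_inversions)
  have "card ?P = card (?P - ?T) + card (?P \<inter> ?T)"
    using card_Int_Diff[OF fin(1), of ?T] by simp
  moreover have "card ?T = card (?T - ?P) + card (?P \<inter> ?T)"
    using card_Int_Diff[OF fin(2), of ?P] by (simp add: Int_commute)
  moreover have "card (sym_diff ?P ?T) = card (?P - ?T) + card (?T - ?P)"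
    using fin by (intro card_Un_disjoint) auto
  ultimately have "weak_le n \<pi> \<tau> \<longleftrightarrow> card (?P - ?T) = 0"
    unfolding weak_le_def perm_length_inv_comp[OF assms] perm_length_eq_card_value_inversions[OF assms(1)]
      perm_length_eq_card_value_inversions[OF assms(2)] by linarith
  then show ?thesis using fin by simp
qed

lemma inj_on_value_inversions: "inj_on (value_inversions n) {\<pi>. \<pi> permutes {1..n}}"
proof (rule inj_onI)
  fix \<pi> \<tau> assume "\<pi> \<in> {\<pi>. \<pi> permutes {1..n}}" "\<tau> \<in> {\<pi>. \<pi> permutes {1..n}}"
    and eq: "value_inversions n \<pi> = value_inversions n \<tau>"
  then have p: "\<pi> permutes {1..n}" and t: "\<tau> permutes {1..n}" by simp_all
  have flip: "inv \<pi> y < inv \<pi> x \<longleftrightarrow> inv \<tau> y < inv \<tau> x" if "x \<in> {1..n}" "y \<in> {1..n}" "x < y" for x y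
    using that eq mem_value_inversions[of x y n \<pi>] mem_value_inversions[of x y n \<tau>] by auto
  have order: "inv \<pi> x < inv \<pi> y \<longleftrightarrow> inv \<tau> x < inv \<tau> y" if "x \<in> {1..n}" "y \<in> {1..n}" for x y
  proof (cases x y rule: linorder_cases)
    case less
    then have "inv \<pi> y \<noteq> inv \<pi> x" "inv \<tau> y \<noteq> inv \<tau> x"
      using permutes_inv_atLeastAtMost(2)[OF p] permutes_inv_atLeastAtMost(2)[OF t] by simp_all
    then show ?thesis using flip[OF that less] by linarith
  next
    case greater
    then show ?thesis using flip[OF that(2,1)] by blast
  qed simp
  \<comment> \<open>The inversion set fixes the relative order of every two values, and a position
    is one more than the number of values standing before it.\<close>
  have rank: "inv \<sigma> x = Suc (card {y \<in> {1..n}. inv \<sigma> y < inv \<sigma> x})"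
    if s: "\<sigma> permutes {1..n}" and x: "x \<in> {1..n}" for \<sigma> x
  proof -
    have "inv \<sigma> ` {y \<in> {1..n}. inv \<sigma> y < inv \<sigma> x} = {1..<inv \<sigma> x}"
    proof (intro equalityI subsetI)
      fix k assume "k \<in> {1..<inv \<sigma> x}"
      moreover have "inv \<sigma> x \<le> n" using permutes_inv_atLeastAtMost(1)[OF s x] by simp
      ultimately have "\<sigma> k \<in> {1..n}" "inv \<sigma> (\<sigma> k) = k"
        using permutes_in_image[OF s, of k] permutes_inverses(2)[OF s] by auto
      then show "k \<in> inv \<sigma> ` {y \<in> {1..n}. inv \<sigma> y < inv \<sigma> x}"
        using \<open>k \<in> {1..<inv \<sigma> x}\<close> by (intro image_eqI[of _ _ "\<sigma> k"]) auto
    qed (use permutes_inv_atLeastAtMost(1)[OF s] in fastforce)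
    moreover have "inj_on (inv \<sigma>) {y \<in> {1..n}. inv \<sigma> y < inv \<sigma> x}"
      using permutes_inj_on[OF permutes_inv[OF s]] .
    ultimately have "card {y \<in> {1..n}. inv \<sigma> y < inv \<sigma> x} = inv \<sigma> x - 1"
      using card_image by fastforce
    then show ?thesis using permutes_inv_atLeastAtMost(1)[OF s x] by simp
  qed
  have "inv \<pi> x = inv \<tau> x" for x
  proof (cases "x \<in> {1..n}")
    case True
    have "{y \<in> {1..n}. inv \<pi> y < inv \<pi> x} = {y \<in> {1..n}. inv \<tau> y < inv \<tau> x}"
      using order True by blast
    then show ?thesis using rank[OF p True] rank[OF t True] by simp
  next
    case False
    then show ?thesis
      using permutes_not_in[OF permutes_inv[OF p]] permutes_not_in[OF permutes_inv[OF t]] by simp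
  qed
  then have "inv \<pi> = inv \<tau>" by blast
  then show "\<pi> = \<tau>" using permutes_inv_inv[OF p] permutes_inv_inv[OF t] by metis
qed

text \<open>
  A transitive and cotransitive set of pairs \<open>a < b\<close> is the inversion set of the permutation that
  lists the values in the total order \<open>prec\<close>, in which exactly the pairs of the set are reversed.
\<close>
lemma ex_permutes_value_inversions:
  assumes sub: "I \<subseteq> shifted_staircase n"
    and trans: "\<And>i j k. (i, j) \<in> I \<Longrightarrow> (j, k) \<in> I \<Longrightarrow> (i, k) \<in> I"
    and cotrans: "\<And>i j k. (i, k) \<in> I \<Longrightarrow> i < j \<Longrightarrow> j < k \<Longrightarrow> (i, j) \<in> I \<or> (j, k) \<in> I"
  shows "\<exists>\<pi>. \<pi> permutes {1..n} \<and> value_inversions n \<pi> = I"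
proof -
  define prec where "prec x y \<longleftrightarrow> (x < y \<and> (x, y) \<notin> I) \<or> (y < x \<and> (y, x) \<in> I)" for x y
  \<comment> \<open>\<open>p x\<close> is the position of the value \<open>x\<close> in the list
    ordered by \<open>prec\<close>, so the permutation sought is \<open>inv p\<close>; outside
    \<open>{1..n}\<close> it must be the identity.\<close>
  define p where "p x = (if x \<in> {1..n} then Suc (card {y \<in> {1..n}. prec y x}) else x)" for x
  have prec_trans: "prec x z" if xy: "prec x y" and yz: "prec y z" for x y z
  proof -
    consider "x < y" "y < z" "(x, y) \<notin> I" "(y, z) \<notin> I" | "x < y" "z < y" "(x, y) \<notin> I" "(z, y) \<in> I"
      | "y < x" "y < z" "(y, x) \<in> I" "(y, z) \<notin> I" | "y < x" "z < y" "(y, x) \<in> I" "(z, y) \<in> I"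
      using xy yz unfolding prec_def by blast
    then show ?thesis
    proof cases
      case 1
      then show ?thesis using cotrans[of x z y] by (auto simp: prec_def)
    next
      case 2
      then show ?thesis using trans[of x z y] cotrans[of z y x]
        by (cases x z rule: linorder_cases) (auto simp: prec_def)
    next
      case 3
      then show ?thesis using trans[of y x z] cotrans[of y x z]
        by (cases x z rule: linorder_cases) (auto simp: prec_def)
    next
      case 4
      then show ?thesis using trans[of z y x] by (auto simp: prec_def)
    qed
  qed
  have irrefl: "\<not> prec x x" for x by (simp add: prec_def)
  have total: "prec x y \<or> prec y x" if "x \<noteq> y" for x y using that by (auto simp: prec_def)
  have less: "p x < p y" if "prec x y" "x \<in> {1..n}" "y \<in> {1..n}" for x y
  proof -
    have "{z \<in> {1..n}. prec z x} \<subset> {z \<in> {1..n}. prec z y}"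
      using that prec_trans irrefl by blast
    then have "card {z \<in> {1..n}. prec z x} < card {z \<in> {1..n}. prec z y}"
      by (intro psubset_card_mono) auto
    then show ?thesis using that by (simp add: p_def)
  qed
  have less_iff: "p x < p y \<longleftrightarrow> prec x y" if "x \<in> {1..n}" "y \<in> {1..n}" for x y
    using less that total irrefl by (metis order_less_asym order_less_irrefl)
  have "inj_on p {1..n}"
    using less total by (intro inj_onI) (metis order_less_irrefl)
  moreover have "p ` {1..n} \<subseteq> {1..n}"
  proof (rule image_subsetI)
    fix x assume x: "x \<in> {1..n}"
    then have "{y \<in> {1..n}. prec y x} \<subset> {1..n}" using irrefl by blast
    then have "card {y \<in> {1..n}. prec y x} < n" using psubset_card_mono[of "{1..n}" "{y \<in> {1..n}. prec y x}"] by simp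
    then show "p x \<in> {1..n}" using x by (auto simp: p_def)
  qed
  ultimately have "bij_betw p {1..n} {1..n}"
    by (metis bij_betw_def endo_inj_surj finite_atLeastAtMost)
  then have p: "p permutes {1..n}" by (rule bij_imp_permutes) (auto simp: p_def)
  have "value_inversions n (inv p) = I"
  proof -
    have "(a, b) \<in> value_inversions n (inv p) \<longleftrightarrow> (a, b) \<in> I" for a b
      using sub less_iff[of b a] unfolding mem_value_inversions permutes_inv_inv[OF p]
      by (auto simp: prec_def shifted_staircase_def)
    then show ?thesis by auto
  qed
  then show ?thesis using permutes_inv[OF p] by blast
qed

text \<open>An interval is a convex set, so the condition forbids \<open>q\<close> to peak strictly
  between two values. It is applied to positions for prefixes and to reversed positions for
  suffixes.\<close>

lemma sublevel_intervals_iff: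
  fixes q :: "nat \<Rightarrow> nat"
  assumes "q ` {1..n} \<subseteq> {1..n}"
  shows "(\<forall>j\<in>{1..n}. \<exists>a b. {v \<in> {1..n}. q v \<le> j} = {a..b}) \<longleftrightarrow>
    (\<forall>x y z. 1 \<le> x \<and> x < y \<and> y < z \<and> z \<le> n \<longrightarrow> q y \<le> max (q x) (q z))"
proof (intro iffI allI ballI impI)
  fix x y z
  assume L: "\<forall>j\<in>{1..n}. \<exists>a b. {v \<in> {1..n}. q v \<le> j} = {a..b}" and xyz: "1 \<le> x \<and> x < y \<and> y < z \<and> z \<le> n"
  have "x \<in> {1..n}" "z \<in> {1..n}" using xyz by auto
  then have "q x \<in> {1..n}" "q z \<in> {1..n}" using assms by blast+
  \<comment> \<open>This is the least threshold whose sublevel set contains both \<open>x\<close>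
    and \<open>z\<close>.\<close>
  then have "max (q x) (q z) \<in> {1..n}" by auto
  then obtain a b where eq: "{v \<in> {1..n}. q v \<le> max (q x) (q z)} = {a..b}" using L by blast
  have "x \<in> {a..b}" "z \<in> {a..b}" using xyz unfolding eq[symmetric] by auto
  then have "y \<in> {a..b}" using xyz by auto
  then show "q y \<le> max (q x) (q z)" unfolding eq[symmetric] by auto
next
  fix j
  assume R: "\<forall>x y z. 1 \<le> x \<and> x < y \<and> y < z \<and> z \<le> n \<longrightarrow> q y \<le> max (q x) (q z)"
  let ?X = "{v \<in> {1..n}. q v \<le> j}"
  show "\<exists>a b. ?X = {a..b}"
  proof (cases "?X = {}")
    case True
    \<comment> \<open>An empty sublevel set still counts as an interval, with bounds in the wrong
      order.\<close>
    have "?X = {1..0}" unfolding True by simp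
    then show ?thesis by blast
  next
    case False
    have fin: "finite ?X" by simp
    have mn: "Min ?X \<in> ?X" and mx: "Max ?X \<in> ?X" using Min_in[OF fin False] Max_in[OF fin False] by blast+
    have "y \<in> ?X" if "y \<in> {Min ?X..Max ?X}" for y
    proof (cases "y = Min ?X \<or> y = Max ?X")
      case True
      then show ?thesis using mn mx by metis
    next
      case False
      then have "Min ?X < y" "y < Max ?X" using that by auto
      moreover have "1 \<le> Min ?X" "Max ?X \<le> n" "q (Min ?X) \<le> j" "q (Max ?X) \<le> j" using mn mx by auto
      moreover from calculation have "q y \<le> max (q (Min ?X)) (q (Max ?X))" using R by blast
      ultimately show ?thesis by auto
    qed
    then have "{Min ?X..Max ?X} \<subseteq> ?X" by blast
    moreover have "?X \<subseteq> {Min ?X..Max ?X}"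
      using Min_le[OF fin] Max_ge[OF fin] unfolding atLeastAtMost_iff subset_iff by blast
    ultimately have "?X = {Min ?X..Max ?X}" by (rule equalityI[rotated])
    then show ?thesis by blast
  qed
qed

text \<open>Only boxes of a common row or column are related, as in the tableau conditions. The
  relation is not transitive, but its ideals and linear extensions are those of the componentwise
  order on the staircase.\<close>

definition box_less :: "nat \<times> nat \<Rightarrow> nat \<times> nat \<Rightarrow> bool" where
  "box_less x y \<longleftrightarrow> (fst x = fst y \<and> snd x < snd y) \<or> (snd x = snd y \<and> fst x < fst y)"

lemma standard_tableaux_eq_linear_extensions: "standard_tableaux D = linear_extensions D box_less"
  unfolding standard_tableaux_def linear_extensions_def box_less_def
  by (intro Collect_cong conj_cong refl) force

text \<open>Closure is phrased with triples i < j < k so that it can be read directly as a condition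
  on the order of three values, and as transitivity and cotransitivity.\<close>

lemma box_ideal_iff:
  "I \<in> order_ideals (shifted_staircase n) box_less \<longleftrightarrow> I \<subseteq> shifted_staircase n \<and>
    (\<forall>i j k. (i, k) \<in> I \<longrightarrow> i < j \<longrightarrow> j < k \<longrightarrow> (i, j) \<in> I) \<and>
    (\<forall>i j k. (j, k) \<in> I \<longrightarrow> 1 \<le> i \<longrightarrow> i < j \<longrightarrow> (i, k) \<in> I)" (is "?L \<longleftrightarrow> ?R")
proof
  assume L: ?L
  then have sub: "I \<subseteq> shifted_staircase n" by (simp add: order_ideals_def)
  have down: "x \<in> I" if "y \<in> I" "x \<in> shifted_staircase n" "box_less x y" for x y
    using L that by (auto simp: order_ideals_def)
  have "(i, j) \<in> I" if "(i, k) \<in> I" "i < j" "j < k" for i j k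
    by (rule down[OF that(1)]) (use sub that in \<open>auto simp: box_less_def shifted_staircase_def\<close>)
  moreover have "(i, k) \<in> I" if "(j, k) \<in> I" "1 \<le> i" "i < j" for i j k
    by (rule down[OF that(1)]) (use sub that in \<open>auto simp: box_less_def shifted_staircase_def\<close>)
  ultimately show ?R using sub by blast
next
  assume R: ?R
  have "x \<in> I" if "y \<in> I" "x \<in> shifted_staircase n" "box_less x y" for x y
  proof -
    obtain a b c d where "x = (a, b)" "y = (c, d)" by fastforce
    moreover from this have ab: "1 \<le> a" "a < b" "b \<le> n" using that by (simp_all add: shifted_staircase_def)
    moreover have "a = c \<and> b < d \<or> b = d \<and> a < c" using that calculation by (auto simp: box_less_def)
    ultimately show ?thesis using R that(1) by blast
  qed
  then show ?L unfolding order_ideals_def mem_Collect_eq conversep_iff using R by blast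
qed

lemma box_filter_iff:
  "I \<in> order_ideals (shifted_staircase n) box_less\<inverse>\<inverse> \<longleftrightarrow> I \<subseteq> shifted_staircase n \<and>
    (\<forall>i j k. (i, j) \<in> I \<longrightarrow> j < k \<longrightarrow> k \<le> n \<longrightarrow> (i, k) \<in> I) \<and>
    (\<forall>i j k. (i, k) \<in> I \<longrightarrow> i < j \<longrightarrow> j < k \<longrightarrow> (j, k) \<in> I)" (is "?L \<longleftrightarrow> ?R")
proof
  assume L: ?L
  then have sub: "I \<subseteq> shifted_staircase n" by (simp add: order_ideals_def)
  have up: "x \<in> I" if "y \<in> I" "x \<in> shifted_staircase n" "box_less y x" for x y
    using L that by (auto simp: order_ideals_def)
  have "(i, k) \<in> I" if "(i, j) \<in> I" "j < k" "k \<le> n" for i j k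
    by (rule up[OF that(1)]) (use sub that in \<open>auto simp: box_less_def shifted_staircase_def\<close>)
  moreover have "(j, k) \<in> I" if "(i, k) \<in> I" "i < j" "j < k" for i j k
    by (rule up[OF that(1)]) (use sub that in \<open>auto simp: box_less_def shifted_staircase_def\<close>)
  ultimately show ?R using sub by blast
next
  assume R: ?R
  have "x \<in> I" if "y \<in> I" "x \<in> shifted_staircase n" "box_less y x" for x y
  proof -
    obtain a b c d where "x = (a, b)" "y = (c, d)" by fastforce
    moreover from this have ab: "1 \<le> a" "a < b" "b \<le> n" using that by (simp_all add: shifted_staircase_def)
    moreover have "a = c \<and> d < b \<or> b = d \<and> c < a" using that calculation by (auto simp: box_less_def)
    ultimately show ?thesis using R that(1) by blast
  qed
  then show ?L unfolding order_ideals_def mem_Collect_eq conversep_iff using R by blast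
qed

text \<open>The move goes up within column \<open>j\<close> first and left within row
  \<open>i'\<close> afterwards; in the other order the intermediate box could fall on or below the
  diagonal.\<close>

lemma box_ideal_down:
  assumes I: "I \<in> order_ideals (shifted_staircase n) box_less"
    and "(i, j) \<in> I" "1 \<le> i'" "i' \<le> i" "i' < j'" "j' \<le> j"
  shows "(i', j') \<in> I"
proof -
  have "(i', j) \<in> I"
    using assms unfolding box_ideal_iff by (cases "i' = i") (blast dest: le_neq_implies_less)+
  then show ?thesis
    using assms unfolding box_ideal_iff by (cases "j' = j") (blast dest: le_neq_implies_less)+
qed

text \<open>Here the move goes right first and down afterwards, again to stay above the
  diagonal.\<close>

lemma box_filter_up:
  assumes J: "J \<in> order_ideals (shifted_staircase n) box_less\<inverse>\<inverse>"
    and "(i, j) \<in> J" "i \<le> i'" "i' < j'" "j \<le> j'" "j' \<le> n"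
  shows "(i', j') \<in> J"
proof -
  have "(i, j') \<in> J"
    using assms unfolding box_filter_iff by (cases "j' = j") (blast dest: le_neq_implies_less)+
  then show ?thesis
    using assms unfolding box_filter_iff by (cases "i' = i") (blast dest: le_neq_implies_less)+
qed

lemma prefix_intervals_iff:
  assumes \<pi>: "\<pi> permutes {1..n}"
  shows "(\<forall>j\<in>{1..n}. \<exists>a b. \<pi> ` {1..j} = {a..b}) \<longleftrightarrow>
    value_inversions n \<pi> \<in> order_ideals (shifted_staircase n) box_less"
proof -
  note inv = permutes_inv_atLeastAtMost[OF \<pi>]
  have "\<pi> ` {1..j} = {v \<in> {1..n}. inv \<pi> v \<le> j}" if "j \<in> {1..n}" for j
  proof (intro equalityI subsetI)
    fix v assume "v \<in> {v \<in> {1..n}. inv \<pi> v \<le> j}"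
    then show "v \<in> \<pi> ` {1..j}" using inv(1)[of v] permutes_inverses(1)[OF \<pi>, of v]
      by (intro image_eqI[of _ _ "inv \<pi> v"]) auto
  next
    fix v assume "v \<in> \<pi> ` {1..j}"
    then obtain i where i: "i \<in> {1..j}" "v = \<pi> i" by blast
    then have "\<pi> i \<in> {1..n}" using permutes_in_image[OF \<pi>, of i] that by auto
    then show "v \<in> {v \<in> {1..n}. inv \<pi> v \<le> j}" using i permutes_inverses(2)[OF \<pi>, of i] by auto
  qed
  then have "(\<forall>j\<in>{1..n}. \<exists>a b. \<pi> ` {1..j} = {a..b}) \<longleftrightarrow>
      (\<forall>j\<in>{1..n}. \<exists>a b. {v \<in> {1..n}. inv \<pi> v \<le> j} = {a..b})" by simp
  also have "\<dots> \<longleftrightarrow> (\<forall>x y z. 1 \<le> x \<and> x < y \<and> y < z \<and> z \<le> n \<longrightarrow> inv \<pi> y \<le> max (inv \<pi> x) (inv \<pi> z))"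
    by (rule sublevel_intervals_iff) (use inv(1) in blast)
  \<comment> \<open>The inequality says that among values x < y < z the middle one never comes last.
    If z precedes x, then y precedes x; if z precedes y, then y precedes x, hence z does: these are
    the two closure rules of an ideal.\<close>
  also have "\<dots> \<longleftrightarrow> value_inversions n \<pi> \<in> order_ideals (shifted_staircase n) box_less" (is "?L \<longleftrightarrow> ?R")
  proof
    assume L: ?L
    have "(i, j) \<in> value_inversions n \<pi>" if "(i, k) \<in> value_inversions n \<pi>" "i < j" "j < k" for i j k
      using that L[rule_format, of i j k] inv(2)[of i j] unfolding mem_value_inversions by auto
    moreover have "(i, k) \<in> value_inversions n \<pi>" if "(j, k) \<in> value_inversions n \<pi>" "1 \<le> i" "i < j" for i j k
      using that L[rule_format, of i j k] inv(2)[of i k] unfolding mem_value_inversions by auto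
    moreover have "value_inversions n \<pi> \<subseteq> shifted_staircase n" by (auto simp: value_inversions_def)
    ultimately show ?R unfolding box_ideal_iff by blast
  next
    assume ?R
    then have R: "\<And>i j k. (i, k) \<in> value_inversions n \<pi> \<Longrightarrow> i < j \<Longrightarrow> j < k \<Longrightarrow> (i, j) \<in> value_inversions n \<pi>"
      "\<And>i j k. (j, k) \<in> value_inversions n \<pi> \<Longrightarrow> 1 \<le> i \<Longrightarrow> i < j \<Longrightarrow> (i, k) \<in> value_inversions n \<pi>"
      unfolding box_ideal_iff by blast+
    show ?L
    proof (intro allI impI)
      fix x y z assume "1 \<le> x \<and> x < y \<and> y < z \<and> z \<le> n"
      then show "inv \<pi> y \<le> max (inv \<pi> x) (inv \<pi> z)"
        using R(1)[of x z y] R(2)[of y z x] unfolding mem_value_inversions by fastforce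
    qed
  qed
  finally show ?thesis .
qed

lemma suffix_intervals_iff:
  assumes \<pi>: "\<pi> permutes {1..n}"
  shows "(\<forall>j\<in>{1..n}. \<exists>a b. \<pi> ` {j..n} = {a..b}) \<longleftrightarrow>
    value_inversions n \<pi> \<in> order_ideals (shifted_staircase n) box_less\<inverse>\<inverse>"
proof -
  note inv = permutes_inv_atLeastAtMost[OF \<pi>]
  \<comment> \<open>Counting positions from the right end turns suffixes into sublevel sets; the
    resulting condition is that the middle of three values never comes first.\<close>
  define q where "q v = Suc n - inv \<pi> v" for v
  have im: "\<pi> ` {Suc n - j..n} = {v \<in> {1..n}. q v \<le> j}" if "j \<in> {1..n}" for j
  proof (intro equalityI subsetI)
    fix v assume "v \<in> {v \<in> {1..n}. q v \<le> j}"
    then show "v \<in> \<pi> ` {Suc n - j..n}" using inv(1)[of v] permutes_inverses(1)[OF \<pi>, of v] that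
      by (intro image_eqI[of _ _ "inv \<pi> v"]) (auto simp: q_def)
  next
    fix v assume "v \<in> \<pi> ` {Suc n - j..n}"
    then obtain i where i: "i \<in> {Suc n - j..n}" "v = \<pi> i" by blast
    then have "\<pi> i \<in> {1..n}" using permutes_in_image[OF \<pi>, of i] that by auto
    then show "v \<in> {v \<in> {1..n}. q v \<le> j}" using i permutes_inverses(2)[OF \<pi>, of i] by (auto simp: q_def)
  qed
  have "(\<forall>j\<in>{1..n}. \<exists>a b. \<pi> ` {j..n} = {a..b}) \<longleftrightarrow>
      (\<forall>j\<in>{1..n}. \<exists>a b. \<pi> ` {Suc n - j..n} = {a..b})" (is "?L \<longleftrightarrow> ?R")
  proof
    assume L: ?L
    have "\<exists>a b. \<pi> ` {Suc n - j..n} = {a..b}" if "j \<in> {1..n}" for j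
    proof -
      have "Suc n - j \<in> {1..n}" using that by auto
      then show ?thesis using L by blast
    qed
    then show ?R by blast
  next
    assume R: ?R
    have "\<exists>a b. \<pi> ` {j..n} = {a..b}" if "j \<in> {1..n}" for j
    proof -
      have "Suc n - j \<in> {1..n}" "Suc n - (Suc n - j) = j" using that by auto
      then show ?thesis using R by metis
    qed
    then show ?L by blast
  qed
  also have "\<dots> \<longleftrightarrow> (\<forall>j\<in>{1..n}. \<exists>a b. {v \<in> {1..n}. q v \<le> j} = {a..b})" using im by simp
  also have "\<dots> \<longleftrightarrow> (\<forall>x y z. 1 \<le> x \<and> x < y \<and> y < z \<and> z \<le> n \<longrightarrow> q y \<le> max (q x) (q z))"
    by (rule sublevel_intervals_iff) (use inv(1) in \<open>fastforce simp: q_def\<close>)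
  also have "\<dots> \<longleftrightarrow> (\<forall>x y z. 1 \<le> x \<and> x < y \<and> y < z \<and> z \<le> n \<longrightarrow> min (inv \<pi> x) (inv \<pi> z) \<le> inv \<pi> y)"
  proof -
    have "q y \<le> max (q x) (q z) \<longleftrightarrow> min (inv \<pi> x) (inv \<pi> z) \<le> inv \<pi> y"
      if "1 \<le> x \<and> x < y \<and> y < z \<and> z \<le> n" for x y z
      using inv(1)[of x] inv(1)[of y] inv(1)[of z] that by (auto simp: q_def)
    then show ?thesis by blast
  qed
  also have "\<dots> \<longleftrightarrow> value_inversions n \<pi> \<in> order_ideals (shifted_staircase n) box_less\<inverse>\<inverse>" (is "?L \<longleftrightarrow> ?R")
  proof
    assume L: ?L
    have "(i, k) \<in> value_inversions n \<pi>" if "(i, j) \<in> value_inversions n \<pi>" "j < k" "k \<le> n" for i j k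
      using that L[rule_format, of i j k] inv(2)[of i k] unfolding mem_value_inversions by auto
    moreover have "(j, k) \<in> value_inversions n \<pi>" if "(i, k) \<in> value_inversions n \<pi>" "i < j" "j < k" for i j k
      using that L[rule_format, of i j k] inv(2)[of j k] unfolding mem_value_inversions by auto
    moreover have "value_inversions n \<pi> \<subseteq> shifted_staircase n" by (auto simp: value_inversions_def)
    ultimately show ?R unfolding box_filter_iff by blast
  next
    assume ?R
    then have R: "\<And>i j k. (i, j) \<in> value_inversions n \<pi> \<Longrightarrow> j < k \<Longrightarrow> k \<le> n \<Longrightarrow> (i, k) \<in> value_inversions n \<pi>"
      "\<And>i j k. (i, k) \<in> value_inversions n \<pi> \<Longrightarrow> i < j \<Longrightarrow> j < k \<Longrightarrow> (j, k) \<in> value_inversions n \<pi>"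
      unfolding box_filter_iff by blast+
    show ?L
    proof (intro allI impI)
      fix x y z assume "1 \<le> x \<and> x < y \<and> y < z \<and> z \<le> n"
      then show "min (inv \<pi> x) (inv \<pi> z) \<le> inv \<pi> y"
        using R(1)[of x y z] R(2)[of x z y] unfolding mem_value_inversions by fastforce
    qed
  qed
  finally show ?thesis .
qed

lemma value_inversions_image_unimodal:
  "value_inversions n ` unimodal_perms n =
    order_ideals (shifted_staircase n) box_less \<union> order_ideals (shifted_staircase n) box_less\<inverse>\<inverse>"
proof (intro equalityI subsetI)
  fix I assume "I \<in> value_inversions n ` unimodal_perms n"
  then show "I \<in> order_ideals (shifted_staircase n) box_less \<union> order_ideals (shifted_staircase n) box_less\<inverse>\<inverse>"
    using prefix_intervals_iff suffix_intervals_iff by (auto simp: unimodal_perms_def)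
next
  fix I assume I: "I \<in> order_ideals (shifted_staircase n) box_less \<union> order_ideals (shifted_staircase n) box_less\<inverse>\<inverse>"
  then have sub: "I \<subseteq> shifted_staircase n" by (auto simp: order_ideals_def)
  have "\<exists>\<pi>. \<pi> permutes {1..n} \<and> value_inversions n \<pi> = I"
  \<comment> \<open>For transitivity an ideal uses only (j, k) and a filter only (i, j); for
    cotransitivity an ideal yields (i, j) and a filter (j, k).\<close>
  proof (rule ex_permutes_value_inversions[OF sub])
    fix i j k assume "(i, j) \<in> I" "(j, k) \<in> I"
    moreover from this have "1 \<le> i" "i < j" "j < k" "k \<le> n"
      using sub by (auto simp: shifted_staircase_def)
    ultimately show "(i, k) \<in> I" using I unfolding Un_iff box_ideal_iff box_filter_iff by blast
  next
    fix i j k assume "(i, k) \<in> I" "i < j" "j < k"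
    then show "(i, j) \<in> I \<or> (j, k) \<in> I" using I unfolding Un_iff box_ideal_iff box_filter_iff by blast
  qed
  then obtain \<pi> where \<pi>: "\<pi> permutes {1..n}" "value_inversions n \<pi> = I" by blast
  then have "\<pi> \<in> unimodal_perms n"
    using I prefix_intervals_iff[OF \<pi>(1)] suffix_intervals_iff[OF \<pi>(1)] by (auto simp: unimodal_perms_def)
  then show "I \<in> value_inversions n ` unimodal_perms n" using \<pi>(2) by blast
qed

section \<open>Chains of ideals and chains of filters combined\<close>

lemma order_ideals_converse:
  "order_ideals D R\<inverse>\<inverse> = (-) D ` order_ideals D R"
proof (intro equalityI subsetI)
  fix I assume "I \<in> order_ideals D R\<inverse>\<inverse>"
  then have "D - I \<in> order_ideals D R" "I = D - (D - I)" by (auto simp: order_ideals_def)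
  then show "I \<in> (-) D ` order_ideals D R" by blast
qed (auto simp: order_ideals_def)

lemma card_maxchain_order_ideals_converse:
  "card {C. pred_on.maxchain (order_ideals D R\<inverse>\<inverse>) (\<subseteq>) C} =
    card {C. pred_on.maxchain (order_ideals D R) (\<subseteq>) C}"
proof -
  have sub: "I \<subseteq> D" if "I \<in> order_ideals D R" for I using that by (simp add: order_ideals_def)
  have "bij_betw ((`) ((-) D)) {C. pred_on.maxchain (order_ideals D R) (\<subseteq>) C}
      {C. pred_on.maxchain ((-) D ` order_ideals D R) (\<subseteq>) C}"
  proof (rule bij_betw_maxchain_image)
    show "inj_on ((-) D) (order_ideals D R)" using sub by (intro inj_onI) blast
    show "I \<subseteq> J \<or> J \<subseteq> I \<longleftrightarrow> D - I \<subseteq> D - J \<or> D - J \<subseteq> D - I"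
      if "I \<in> order_ideals D R" "J \<in> order_ideals D R" for I J
      using sub[OF that(1)] sub[OF that(2)] by blast
  qed
  then show ?thesis unfolding order_ideals_converse by (simp add: bij_betw_same_card)
qed

text \<open>The corner (1, 2) lies in every nonempty ideal, and a filter containing it is the whole
  staircase.\<close>

lemma box_ideal_subset_filter:
  assumes I: "I \<in> order_ideals (shifted_staircase n) box_less"
    and J: "J \<in> order_ideals (shifted_staircase n) box_less\<inverse>\<inverse>"
    and "I \<subseteq> J"
  shows "I = {} \<or> J = shifted_staircase n"
proof (cases "I = {}")
  case False
  then obtain i j where ij: "(i, j) \<in> I" by auto
  then have "1 \<le> i" "i < j" using I by (auto simp: order_ideals_def shifted_staircase_def)
  then have "(1, 2) \<in> J" using box_ideal_down[OF I ij, of 1 2] assms(3) by auto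
  then have "shifted_staircase n \<subseteq> J"
    using box_filter_up[OF J] by (fastforce simp: shifted_staircase_def)
  then show ?thesis using J by (auto simp: order_ideals_def)
qed simp

text \<open>Dually, (n - 1, n) lies in every nonempty filter and generates the whole staircase as an
  ideal.\<close>

lemma box_filter_subset_ideal:
  assumes I: "I \<in> order_ideals (shifted_staircase n) box_less"
    and J: "J \<in> order_ideals (shifted_staircase n) box_less\<inverse>\<inverse>"
    and "J \<subseteq> I"
  shows "J = {} \<or> I = shifted_staircase n"
proof (cases "J = {}")
  case False
  then obtain i j where ij: "(i, j) \<in> J" by auto
  then have "1 \<le> i" "i < j" "j \<le> n" using J by (auto simp: order_ideals_def shifted_staircase_def)
  then have "(n - 1, n) \<in> I" using box_filter_up[OF J ij, of "n - 1" n] assms(3) by auto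
  then have "(a, b) \<in> I" if "1 \<le> a" "a < b" "b \<le> n" for a b
    using box_ideal_down[OF I, of "n - 1" n a b] that by auto
  then have "shifted_staircase n \<subseteq> I" by (auto simp: shifted_staircase_def)
  then show ?thesis using I by (auto simp: order_ideals_def)
qed simp

text \<open>The bound on \<open>n\<close> separates the two families: for n = 2 the staircase is a
  single box, ideals and filters coincide, and there is one maximal chain instead of two.\<close>

lemma card_maximal_chains:
  assumes "n > 2"
  shows "card (maximal_chains_weak_unimodal n) = 2 * card (standard_tableaux (shifted_staircase n))"
proof -
  let ?D = "shifted_staircase n"
  let ?A = "order_ideals ?D box_less" and ?B = "order_ideals ?D box_less\<inverse>\<inverse>"
  have perm: "\<pi> permutes {1..n}" if "\<pi> \<in> unimodal_perms n" for \<pi> using that by (simp add: unimodal_perms_def)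
  have "bij_betw ((`) (value_inversions n)) (maximal_chains_weak_unimodal n)
      {C. pred_on.maxchain (value_inversions n ` unimodal_perms n) (\<subseteq>) C}"
    unfolding maximal_chains_weak_unimodal_def
    by (rule bij_betw_maxchain_image)
      (use perm weak_le_iff_value_inversions in \<open>auto intro: inj_on_subset[OF inj_on_value_inversions]\<close>)
  then have "card (maximal_chains_weak_unimodal n) = card {C. pred_on.maxchain (?A \<union> ?B) (\<subseteq>) C}"
    unfolding value_inversions_image_unimodal by (rule bij_betw_same_card)
  also have "\<dots> = card {C. pred_on.maxchain ?A (\<subseteq>) C} + card {C. pred_on.maxchain ?B (\<subseteq>) C}"
  proof (rule card_maxchain_Un)
    show "finite ?A" "finite ?B"
      by (rule finite_subset[of _ "Pow ?D"]; auto simp: order_ideals_def finite_shifted_staircase)+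
    have subD: "X \<subseteq> ?D" if "X \<in> ?A \<union> ?B" for X using that by (auto simp: order_ideals_def)
    have triv: "X = {} \<or> X = ?D" if "X \<in> ?A \<inter> ?B" for X
      using box_ideal_subset_filter[of X n X] that by blast
    show "(\<subseteq>)\<^sup>=\<^sup>= K X \<or> (\<subseteq>)\<^sup>=\<^sup>= X K" if "K \<in> ?A \<inter> ?B" "X \<in> ?A \<union> ?B" for K X
      using triv[OF that(1)] subD[OF that(2)] by auto
    have trivAB: "{} \<in> ?A" "{} \<in> ?B" "?D \<in> ?A" "?D \<in> ?B" by (auto simp: order_ideals_def)
    show "\<not> I \<subseteq> J \<and> \<not> J \<subseteq> I" if I: "I \<in> ?A - ?B" and J: "J \<in> ?B - ?A" for I J
      using box_ideal_subset_filter[of I n J] box_filter_subset_ideal[of I n J] I J trivAB by blast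
    \<comment> \<open>Only the empty set and the full staircase are both ideal and filter, so a
      single extreme box witnesses that neither family contains the other.\<close>
    have "{(1, 2)} \<in> ?A" using assms unfolding box_ideal_iff by (auto simp: shifted_staircase_def)
    moreover have "(1, 3) \<in> ?D" using assms by (simp add: shifted_staircase_def)
    then have "{(1, 2)} \<noteq> ?D" by (metis Pair_inject numeral_eq_iff semiring_norm(88) singletonD)
    ultimately show "\<not> ?A \<subseteq> ?B" using triv[of "{(1, 2)}"] by blast
    have "{(n - 1, n)} \<in> ?B" using assms unfolding box_filter_iff by (auto simp: shifted_staircase_def)
    moreover have "(1, 2) \<in> ?D" using assms by (simp add: shifted_staircase_def)
    then have "{(n - 1, n)} \<noteq> ?D" using assms by auto
    ultimately show "\<not> ?B \<subseteq> ?A" using triv[of "{(n - 1, n)}"] by blast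
  qed
  also have "\<dots> = 2 * card {C. pred_on.maxchain ?A (\<subseteq>) C}"
    by (simp add: card_maxchain_order_ideals_converse)
  also have "card {C. pred_on.maxchain ?A (\<subseteq>) C} = card (linear_extensions ?D box_less)"
    by (rule card_maxchain_order_ideals[where r = "\<lambda>x. fst x + snd x"])
      (auto simp: finite_shifted_staircase box_less_def)
  finally show ?thesis by (simp add: standard_tableaux_eq_linear_extensions)
qed

section \<open>Schur's weight of a strict partition\<close>

lemma degree_prod_linear: "degree (\<Prod>t\<in>S. [:- u t, 1:]) = card S"
  for u :: "'b \<Rightarrow> 'a::idom"
proof (cases "finite S")
  case True
  then show ?thesis by (subst degree_prod_eq_sum_degree) auto
qed simp

lemma lead_coeff_prod_linear: "coeff (\<Prod>t\<in>S. [:- u t, 1:]) (card S) = 1"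
  for u :: "'b \<Rightarrow> 'a::idom"
proof -
  have "lead_coeff (\<Prod>t\<in>S. [:- u t, 1:]) = 1" by (simp add: lead_coeff_prod)
  then show ?thesis by (simp add: degree_prod_linear)
qed

lemma subleading_coeff_prod_linear:
  fixes u :: "'b \<Rightarrow> 'a::idom"
  assumes "finite S" "S \<noteq> {}"
  shows "coeff (\<Prod>t\<in>S. [:- u t, 1:]) (card S - 1) = - (\<Sum>t\<in>S. u t)"
  using assms
proof (induction S rule: finite_ne_induct)
  case (insert x S)
  obtain k where k: "card S = Suc k" using insert by (metis card_eq_0_iff not0_implies_Suc)
  have "coeff ([:- u x, 1:] * (\<Prod>t\<in>S. [:- u t, 1:])) (card S) =
      - u x * coeff (\<Prod>t\<in>S. [:- u t, 1:]) (card S) + coeff (\<Prod>t\<in>S. [:- u t, 1:]) (card S - 1)"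
    by (simp add: k)
  then show ?case using insert by (simp add: lead_coeff_prod_linear)
qed simp

text \<open>The degree bound makes \<open>p\<close> equal to its Lagrange interpolant at the nodes
  \<open>u s\<close>; each summand is the top coefficient of one interpolation term
  \<open>q s\<close>.\<close>

lemma sum_divided_difference:
  fixes u :: "'b \<Rightarrow> 'a::field" and p :: "'a poly"
  assumes fin: "finite S" and inj: "inj_on u S" and deg: "degree p < card S"
  shows "(\<Sum>s\<in>S. poly p (u s) / (\<Prod>t\<in>S-{s}. u s - u t)) = coeff p (card S - 1)"
proof -
  define q where "q s = smult (poly p (u s) / (\<Prod>t\<in>S-{s}. u s - u t)) (\<Prod>t\<in>S-{s}. [:- u t, 1:])" for s
  have card: "card (S - {s}) = card S - 1" if "s \<in> S" for s using that by simp
  have degq: "degree (q s) \<le> card S - 1" if "s \<in> S" for s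
    unfolding q_def using degree_smult_le degree_prod_linear[of u "S - {s}"] card[OF that] by metis
  have "p = (\<Sum>s\<in>S. q s)"
  proof (rule poly_eqI_degree[where A = "u ` S"])
    fix x assume "x \<in> u ` S"
    then obtain r where r: "r \<in> S" "x = u r" by blast
    have "poly (q s) x = 0" if "s \<in> S" "s \<noteq> r" for s
    proof -
      have "(\<Prod>t\<in>S-{s}. x - u t) = 0" using fin r that by (intro prod_zero) auto
      then show ?thesis by (simp add: q_def poly_prod)
    qed
    then have "(\<Sum>s\<in>S. poly (q s) x) = (\<Sum>s\<in>{r}. poly (q s) x)"
      using fin r by (intro sum.mono_neutral_right) auto
    moreover have "(\<Prod>t\<in>S-{r}. x - u t) \<noteq> 0"
      using fin r inj_onD[OF inj] by auto
    ultimately show "poly p x = poly (\<Sum>s\<in>S. q s) x"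
      using r by (simp add: poly_sum q_def poly_prod)
  next
    show "degree p < card (u ` S)" using deg inj by (simp add: card_image)
    have "degree (\<Sum>s\<in>S. q s) \<le> card S - 1" using degq fin by (intro degree_sum_le) auto
    then show "degree (\<Sum>s\<in>S. q s) < card (u ` S)" using deg inj by (simp add: card_image)
  qed
  then have "coeff p (card S - 1) = (\<Sum>s\<in>S. coeff (q s) (card S - 1))" by (metis coeff_sum)
  also have "\<dots> = (\<Sum>s\<in>S. poly p (u s) / (\<Prod>t\<in>S-{s}. u s - u t))"
  proof (rule sum.cong[OF refl])
    fix s assume "s \<in> S"
    then show "coeff (q s) (card S - 1) = poly p (u s) / (\<Prod>t\<in>S-{s}. u s - u t)"
      using lead_coeff_prod_linear[of u "S - {s}"] unfolding card[OF \<open>s \<in> S\<close>] by (simp add: q_def)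
  qed
  finally show ?thesis by simp
qed

text \<open>The monic polynomials with roots \<open>v t\<close> and with roots \<open>u t\<close>
  differ by a polynomial \<open>p\<close> of degree below \<open>card S\<close>. At the nodes the
  second one vanishes, so \<open>p\<close> takes the numerators as values, and its next coefficient
  is the difference of the root sums.\<close>

lemma sum_prod_quotient:
  fixes u v :: "'b \<Rightarrow> 'a::field"
  assumes fin: "finite S" and inj: "inj_on u S"
  shows "(\<Sum>s\<in>S. (\<Prod>t\<in>S. u s - v t) / (\<Prod>t\<in>S-{s}. u s - u t)) = (\<Sum>s\<in>S. u s - v s)"
proof (cases "S = {}")
  case False
  let ?P = "\<lambda>w. \<Prod>t\<in>S. [:- w t, 1:] :: 'a poly"
  define p where "p = ?P v - ?P u"
  have pos: "card S > 0" using fin False by (simp add: card_gt_0_iff)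
  have "degree p < card S"
  proof -
    have "degree p \<le> card S" unfolding p_def
      by (intro degree_diff_le) (simp_all add: degree_prod_linear)
    moreover have "coeff p (card S) = 0" by (simp add: p_def lead_coeff_prod_linear)
    ultimately show ?thesis using pos
      by (metis degree_0 leading_coeff_0_iff le_neq_implies_less)
  qed
  then have "(\<Sum>s\<in>S. poly p (u s) / (\<Prod>t\<in>S-{s}. u s - u t)) = coeff p (card S - 1)"
    by (rule sum_divided_difference[OF fin inj])
  moreover have "coeff p (card S - 1) = (\<Sum>s\<in>S. u s - v s)"
    using fin False by (simp add: p_def subleading_coeff_prod_linear sum_subtractf del: One_nat_def)
  moreover have "poly p (u s) = (\<Prod>t\<in>S. u s - v t)" if "s \<in> S" for s
  proof -
    have "(\<Prod>t\<in>S. u s - u t) = 0" using fin that by (intro prod_zero) auto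
    then show ?thesis by (simp add: p_def poly_prod)
  qed
  ultimately show ?thesis by simp
qed simp

text \<open>A strict partition is encoded as the set of its parts: no ordering of rows has to be
  maintained, and removing a box exchanges one element for its predecessor.\<close>

definition schur_weight :: "nat set \<Rightarrow> real" where
  "schur_weight S = (\<Prod>s\<in>S. 1 / fact s) *
     (\<Prod>(s, t) | s \<in> S \<and> t \<in> S \<and> s < t. (real t - real s) / (real t + real s))"

text \<open>The absolute value treats partners above and below \<open>x\<close> uniformly.\<close>

lemma schur_weight_insert:
  assumes fin: "finite S" and x: "x \<notin> S"
  shows "schur_weight (insert x S) =
    schur_weight S * (1 / fact x) * (\<Prod>s\<in>S. \<bar>real x - real s\<bar> / (real x + real s))"
proof -
  let ?f = "\<lambda>(s, t). (real t - real s) / (real t + real s)"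
  let ?P = "{(s, t). s \<in> S \<and> t \<in> S \<and> s < t}"
  let ?g = "\<lambda>s. \<bar>real x - real s\<bar> / (real x + real s)"
  have finP: "finite ?P" by (rule finite_subset[of _ "S \<times> S"]) (use fin in auto)
  have eq: "{(s, t). s \<in> insert x S \<and> t \<in> insert x S \<and> s < t} =
      ?P \<union> (Pair x ` {t \<in> S. x < t} \<union> (\<lambda>s. (s, x)) ` {s \<in> S. s < x})" by auto
  have S: "S = {t \<in> S. x < t} \<union> {s \<in> S. s < x}" using x by (auto simp: not_less_iff_gr_or_eq)
  have "prod ?f {(s, t). s \<in> insert x S \<and> t \<in> insert x S \<and> s < t} =
      prod ?f ?P * (prod ?f (Pair x ` {t \<in> S. x < t}) * prod ?f ((\<lambda>s. (s, x)) ` {s \<in> S. s < x}))"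
    unfolding eq using fin finP x by (subst prod.union_disjoint; (subst prod.union_disjoint)?) auto
  also have "prod ?f (Pair x ` {t \<in> S. x < t}) = prod ?g {t \<in> S. x < t}"
    by (subst prod.reindex) (auto simp: inj_on_def abs_if add.commute intro!: prod.cong)
  also have "prod ?f ((\<lambda>s. (s, x)) ` {s \<in> S. s < x}) = prod ?g {s \<in> S. s < x}"
    by (subst prod.reindex) (auto simp: inj_on_def abs_if intro!: prod.cong)
  also have "prod ?g {t \<in> S. x < t} * prod ?g {s \<in> S. s < x} = prod ?g S"
    using fin by (subst (3) S, subst prod.union_disjoint) auto
  finally show ?thesis using fin x by (simp add: schur_weight_def)
qed

lemma schur_weight_insert_0:
  assumes "finite S" "0 \<notin> S"
  shows "schur_weight (insert 0 S) = schur_weight S"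
proof -
  have "(\<Prod>s\<in>S. \<bar>real 0 - real s\<bar> / (real 0 + real s)) = 1"
    using assms by (intro prod.neutral) (auto intro: gr0I)
  then show ?thesis using assms by (simp add: schur_weight_insert)
qed

text \<open>
  With \<open>u s = s (s - 1)\<close> and \<open>v s = s (s + 1)\<close> the quotient of the two weights is
  \<open>s \<Prod> (u s - v t) / (u s - u t)\<close> over \<open>t \<noteq> s\<close>, and \<open>v s - u s = 2 s\<close>, so that the sum is
  evaluated by Lagrange interpolation. The terms excluded on the left vanish, as \<open>u s = v (s - 1)\<close>.
\<close>
lemma schur_weight_rec:
  assumes fin: "finite S" and pos: "0 \<notin> S"
  shows "(\<Sum>s | s \<in> S \<and> s - 1 \<notin> S. schur_weight (insert (s - 1) (S - {s}))) =
    real (\<Sum>S) * schur_weight S"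
proof -
  define u v where "u s = real s * (real s - 1)" and "v s = real s * (real s + 1)" for s :: nat
  let ?q = "\<lambda>s. (\<Prod>t\<in>S. u s - v t) / (\<Prod>t\<in>S-{s}. u s - u t)"
  have step: "schur_weight (insert (s - 1) (S - {s})) = - schur_weight S * ?q s / 2"
    if s: "s \<in> S" "s - 1 \<notin> S" for s
  proof -
    let ?X = "S - {s}"
    have s0: "s > 0" using pos s by (metis gr0I)
    have quot: "\<bar>real (s - 1) - real t\<bar> / (real (s - 1) + real t) =
        \<bar>real s - real t\<bar> / (real s + real t) * ((u s - v t) / (u s - u t))" if "t \<in> ?X" for t
    proof -
      have t: "t \<noteq> s" "t \<noteq> s - 1" "t > 0" using that s pos by (auto intro: gr0I)
      \<comment> \<open>Since \<open>t\<close> is an integer other than s and s - 1, the numbers s -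
        t and s - 1 - t have the same sign.\<close>
      have sgn: "\<bar>real (s - 1) - real t\<bar> * (real s - real t) = \<bar>real s - real t\<bar> * (real s - 1 - real t)"
        using t s0 by (cases "t < s") (auto simp: of_nat_diff abs_if algebra_simps)
      have d: "real s - real t \<noteq> 0" "real s + real t \<noteq> 0" "real s + real t - 1 \<noteq> 0"
        using t s0 by auto
      have e: "real (s - 1) + real t = real s + real t - 1" using s0 by (simp add: of_nat_diff)
      have uv: "u s - v t = (real s - 1 - real t) * (real s + real t)"
        "u s - u t = (real s - real t) * (real s + real t - 1)"
        by (simp_all add: u_def v_def algebra_simps)
      have "\<bar>real (s - 1) - real t\<bar> / (real (s - 1) + real t) =
          \<bar>real (s - 1) - real t\<bar> * (real s - real t) / ((real s - real t) * (real s + real t - 1))"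
        using d e by simp
      also have "\<dots> = \<bar>real s - real t\<bar> * (real s - 1 - real t) / ((real s - real t) * (real s + real t - 1))"
        by (simp only: sgn)
      finally show ?thesis unfolding uv using d by simp
    qed
    \<comment> \<open>The factor for t = s is split off: its s matches the change from
      \<open>fact s\<close> to \<open>fact (s - 1)\<close>, and its -2 is the reason for the
      division by -2 in \<open>step\<close>.\<close>
    have "u s - v s = - 2 * real s" by (simp add: u_def v_def algebra_simps)
    then have q: "?q s = - 2 * real s * (\<Prod>t\<in>?X. (u s - v t) / (u s - u t))"
      using fin s by (simp add: prod.remove[of S s] prod_dividef)
    have "schur_weight (insert (s - 1) ?X) = schur_weight ?X * (1 / fact (s - 1)) *
        ((\<Prod>t\<in>?X. \<bar>real s - real t\<bar> / (real s + real t)) * (\<Prod>t\<in>?X. (u s - v t) / (u s - u t)))"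
      using fin s quot by (subst schur_weight_insert) (auto simp flip: prod.distrib)
    moreover have "schur_weight S = schur_weight ?X * (1 / fact s) *
        (\<Prod>t\<in>?X. \<bar>real s - real t\<bar> / (real s + real t))"
      using schur_weight_insert[of ?X s] fin s by (simp add: insert_absorb)
    moreover have "(1::real) / fact (s - 1) = real s * (1 / fact s)"
      using s0 by (simp add: fact_reduce)
    ultimately show ?thesis unfolding q by (simp only:) simp
  qed
  have zero: "?q s = 0" if s: "s \<in> S" "s - 1 \<in> S" for s
  proof -
    have "u s - v (s - 1) = 0" using s pos by (cases s) (auto simp: u_def v_def)
    then have "(\<Prod>t\<in>S. u s - v t) = 0" using fin s by (intro prod_zero) auto
    then show ?thesis by simp
  qed
  have inj: "inj_on u S"
  proof (rule inj_onI)
    fix s t assume st: "s \<in> S" "t \<in> S" "u s = u t"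
    then have "(real s - real t) * (real s + real t - 1) = 0" by (simp add: u_def algebra_simps)
    moreover have "s > 0" "t > 0" using st pos by (auto intro: gr0I)
    \<comment> \<open>The other root s + t = 1 is excluded because both lengths are
      positive.\<close>
    ultimately show "s = t" by auto
  qed
  have "(\<Sum>s | s \<in> S \<and> s - 1 \<notin> S. schur_weight (insert (s - 1) (S - {s}))) =
      (\<Sum>s | s \<in> S \<and> s - 1 \<notin> S. - schur_weight S * ?q s / 2)" using step by simp
  also have "\<dots> = (\<Sum>s\<in>S. - schur_weight S * ?q s / 2)"
    using fin zero by (intro sum.mono_neutral_left) auto
  also have "\<dots> = - schur_weight S / 2 * (\<Sum>s\<in>S. ?q s)"
    by (simp add: sum_distrib_left mult.commute)
  also have "(\<Sum>s\<in>S. ?q s) = (\<Sum>s\<in>S. u s - v s)" by (rule sum_prod_quotient[OF fin inj])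
  also have "\<dots> = - 2 * real (\<Sum>S)"
    unfolding of_nat_sum sum_distrib_left
    by (intro sum.cong) (simp_all add: u_def v_def algebra_simps)
  also have "- schur_weight S / 2 * \<dots> = real (\<Sum>S) * schur_weight S" by simp
  finally show ?thesis .
qed

text \<open>Adding the part m + 1 contributes 1/(m+1)! times the product of (m+1-s)/(m+1+s); the
  numerators multiply to m!, and the denominators extend (m+1)! to (2m+1)!.\<close>

lemma schur_weight_staircase:
  "schur_weight {1..m} = (\<Prod>i<m. fact i / fact (2 * i + 1))"
proof (induction m)
  case 0
  then show ?case by (simp add: schur_weight_def)
next
  case (Suc m)
  have num: "(\<Prod>s=1..m. real (Suc m) - real s) = fact m"
  proof -
    have "(\<Prod>s=1..m. real (Suc m) - real s) = (\<Prod>s=1..m. real s)"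
      by (rule prod.reindex_bij_witness[of _ "\<lambda>s. Suc m - s" "\<lambda>s. Suc m - s"]) (auto simp: of_nat_diff)
    then show ?thesis by (simp add: fact_prod)
  qed
  \<comment> \<open>The upper bound \<open>k\<close> is decoupled from \<open>m\<close> so that the
    induction runs with the factors held fixed.\<close>
  have den: "fact (Suc m) * (\<Prod>s=1..k. real (Suc m) + real s) = fact (Suc m + k)" for k
    by (induction k) (simp_all add: algebra_simps)
  have den': "fact (2 * m + 1) = fact (Suc m) * (\<Prod>s=1..m. real (Suc m) + real s)"
    unfolding den by (simp add: mult_2 del: fact_Suc)
  have "(\<Prod>s=1..m. \<bar>real (Suc m) - real s\<bar> / (real (Suc m) + real s)) =
      (\<Prod>s=1..m. real (Suc m) - real s) / (\<Prod>s=1..m. real (Suc m) + real s)"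
    by (subst prod_dividef[symmetric]) (auto intro!: prod.cong)
  then have quot: "(1 / fact (Suc m)) * (\<Prod>s=1..m. \<bar>real (Suc m) - real s\<bar> / (real (Suc m) + real s)) =
      fact m / fact (2 * m + 1)"
    unfolding num den' by (simp del: of_nat_Suc fact_Suc prod_dividef)
  have "{1..Suc m} = insert (Suc m) {1..m}" by auto
  then have "schur_weight {1..Suc m} = schur_weight {1..m} * ((1 / fact (Suc m)) *
      (\<Prod>s=1..m. \<bar>real (Suc m) - real s\<bar> / (real (Suc m) + real s)))"
    by (simp only: mult.assoc[symmetric]) (rule schur_weight_insert, simp_all)
  then show ?case unfolding quot Suc by simp
qed

section \<open>Shifted tableaux\<close>

definition row_length :: "(nat \<times> nat) set \<Rightarrow> nat \<Rightarrow> nat" where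
  "row_length I i = card (I `` {i})"

text \<open>Restricting to the domain omits empty rows, so for a finite diagram 0 never occurs as a
  part.\<close>

definition row_lengths :: "(nat \<times> nat) set \<Rightarrow> nat set" where
  "row_lengths I = row_length I ` Domain I"

lemma row_length_pos_iff: "finite I \<Longrightarrow> 0 < row_length I i \<longleftrightarrow> i \<in> Domain I"
  by (auto simp: row_length_def card_gt_0_iff finite_Image)

lemma row_length_remove:
  assumes "finite I" "(i, j) \<in> I"
  shows "row_length (I - {(i, j)}) k = (if k = i then row_length I i - 1 else row_length I k)"
proof -
  have "(I - {(i, j)}) `` {k} = (if k = i then I `` {i} - {j} else I `` {k})" by auto
  then show ?thesis using assms by (simp add: row_length_def)
qed

lemma finite_box_ideal:
  "I \<in> order_ideals (shifted_staircase n) R \<Longrightarrow> finite I"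
  by (auto simp: order_ideals_def intro: finite_subset[OF _ finite_shifted_staircase])

text \<open>Closure to the left makes row \<open>i\<close> a gapless run starting next to the
  diagonal, at column i + 1, so its length determines it.\<close>

lemma mem_box_ideal_iff:
  assumes I: "I \<in> order_ideals (shifted_staircase n) box_less"
  shows "(i, j) \<in> I \<longleftrightarrow> i < j \<and> j \<le> i + row_length I i"
proof -
  let ?R = "I `` {i}"
  have fin: "finite ?R" using finite_box_ideal[OF I] by (simp add: finite_Image)
  have less: "1 \<le> i" "i < k" if "(i, k) \<in> I" for k
    using I that by (auto simp: order_ideals_def shifted_staircase_def)
  have "?R = {i<..i + row_length I i}"
  proof (cases "?R = {}")
    case True
    then show ?thesis by (simp add: row_length_def)
  next
    case False
    have mx: "(i, Max ?R) \<in> I" using Max_in[OF fin False] by blast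
    have "?R = {i<..Max ?R}"
    proof (intro equalityI subsetI)
      fix k assume "k \<in> ?R"
      then show "k \<in> {i<..Max ?R}" using less Max_ge[OF fin] by auto
    next
      fix k assume "k \<in> {i<..Max ?R}"
      then show "k \<in> ?R" using box_ideal_down[OF I mx, of i k] less[OF mx] by auto
    qed
    moreover from this have "card ?R = Max ?R - i" by (metis card_greaterThanAtMost)
    ultimately show ?thesis using less(2)[OF mx] by (simp add: row_length_def)
  qed
  then have "j \<in> ?R \<longleftrightarrow> j \<in> {i<..i + row_length I i}" by simp
  then show ?thesis by simp
qed

text \<open>The last box of row \<open>k\<close> forces the box of row \<open>i\<close> in the same
  column; as row \<open>i\<close> starts k - i columns earlier, it is longer by at least that
  much.\<close>

lemma row_length_decreasing:
  assumes I: "I \<in> order_ideals (shifted_staircase n) box_less"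
    and "1 \<le> i" "i < k" "k \<in> Domain I"
  shows "row_length I k + (k - i) \<le> row_length I i"
proof -
  have "(k, k + row_length I k) \<in> I"
    using assms row_length_pos_iff[OF finite_box_ideal[OF I]] by (simp add: mem_box_ideal_iff[OF I])
  then have "(i, k + row_length I k) \<in> I" using box_ideal_down[OF I] assms by auto
  then show ?thesis using assms by (simp add: mem_box_ideal_iff[OF I])
qed

lemma Domain_box_ideal:
  "I \<in> order_ideals (shifted_staircase n) box_less \<Longrightarrow> i \<in> Domain I \<Longrightarrow> 1 \<le> i"
  by (auto simp: order_ideals_def shifted_staircase_def)

lemma inj_on_row_length:
  assumes I: "I \<in> order_ideals (shifted_staircase n) box_less"
  shows "inj_on (row_length I) (Domain I)"
proof (rule linorder_inj_onI)
  fix i k assume "i < k" "i \<in> Domain I" "k \<in> Domain I"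
  then show "row_length I i \<noteq> row_length I k"
    using row_length_decreasing[OF I, of i k] Domain_box_ideal[OF I] by fastforce
qed auto

lemma card_eq_sum_row_lengths:
  assumes I: "I \<in> order_ideals (shifted_staircase n) box_less"
  shows "card I = \<Sum>(row_lengths I)"
proof -
  have fin: "finite I" by (rule finite_box_ideal[OF I])
  have "I = Sigma (Domain I) (\<lambda>i. I `` {i})" by auto
  then have "card I = (\<Sum>i\<in>Domain I. row_length I i)"
    using card_SigmaI[of "Domain I" "\<lambda>i. I `` {i}"] fin
    by (simp add: row_length_def finite_Domain finite_Image)
  then show ?thesis by (simp add: row_lengths_def sum.reindex[OF inj_on_row_length[OF I]])
qed

text \<open>
  An emptied row disappears from the set of row lengths, but inserting \<open>0\<close> does not change the weight.
\<close>
lemma schur_weight_row_lengths_remove: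
  assumes I: "I \<in> order_ideals (shifted_staircase n) box_less" and ij: "(i, j) \<in> I"
  shows "schur_weight (row_lengths (I - {(i, j)})) =
    schur_weight (insert (row_length I i - 1) (row_lengths I - {row_length I i}))"
proof -
  let ?I' = "I - {(i, j)}" and ?s = "row_length I i"
  have fin: "finite I" by (rule finite_box_ideal[OF I])
  have i: "i \<in> Domain I" using ij by blast
  have s: "?s > 0" using i row_length_pos_iff[OF fin] by blast
  have len: "row_length ?I' k = (if k = i then ?s - 1 else row_length I k)" for k
    by (rule row_length_remove[OF fin ij])
  have dom: "k \<in> Domain ?I' \<longleftrightarrow> (if k = i then ?s > 1 else k \<in> Domain I)" for k
    using len row_length_pos_iff[of ?I' k] row_length_pos_iff[OF fin, of k] fin by auto
  \<comment> \<open>No other row has length \<open>?s\<close>, so deleting this value forgets row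
    \<open>i\<close> alone.\<close>
  have rest: "row_lengths I - {?s} = row_length I ` (Domain I - {i})"
    using inj_on_row_length[OF I] i unfolding row_lengths_def inj_on_def by blast
  have rest': "row_length ?I' ` (Domain I - {i}) = row_lengths I - {?s}"
    unfolding rest using len by (intro image_cong) auto
  show ?thesis
  proof (cases "?s = 1")
    case True
    then have "k \<in> Domain ?I' \<longleftrightarrow> k \<in> Domain I - {i}" for k unfolding dom by simp
    then have "Domain ?I' = Domain I - {i}" by blast
    then have "row_lengths ?I' = row_lengths I - {?s}" using rest' by (simp add: row_lengths_def)
    moreover have "0 \<notin> row_lengths I" using row_length_pos_iff[OF fin] by (force simp: row_lengths_def)
    moreover have "finite (row_lengths I)" using fin by (simp add: row_lengths_def finite_Domain)
    ultimately show ?thesis using True schur_weight_insert_0[of "row_lengths I - {?s}"] by simp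
  next
    case False
    then have "k \<in> Domain ?I' \<longleftrightarrow> k \<in> insert i (Domain I - {i})" for k unfolding dom using s by simp
    then have "Domain ?I' = insert i (Domain I - {i})" by blast
    then have "row_lengths ?I' = insert (?s - 1) (row_lengths I - {?s})"
      unfolding rest'[symmetric] using len[of i] by (simp only: row_lengths_def image_insert refl if_True)
    then show ?thesis by simp
  qed
qed

text \<open>The last box of a row of length s is removable unless the next row reaches the same
  column, which means that it has length s - 1. Since lengths drop strictly, a row of length s - 1
  can only be the next one, so the condition is visible in the set of lengths.\<close>

lemma bij_betw_corners:
  assumes I: "I \<in> order_ideals (shifted_staircase n) box_less"
  shows "bij_betw (\<lambda>x. row_length I (fst x)) {x \<in> I. \<forall>y\<in>I. \<not> box_less x y}
    {s \<in> row_lengths I. s - 1 \<notin> row_lengths I}" (is "bij_betw ?f ?M ?S")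
proof -
  have fin: "finite I" by (rule finite_box_ideal[OF I])
  note mem = mem_box_ideal_iff[OF I] and pos = row_length_pos_iff[OF fin]
  have corner: "j = i + row_length I i" "(k, j) \<notin> I" if x: "(i, j) \<in> ?M" and k: "i < k" for i j k
  proof -
    have ij: "(i, j) \<in> I" "\<And>y. y \<in> I \<Longrightarrow> \<not> box_less (i, j) y" using x by auto
    have "(i, i + row_length I i) \<in> I" using ij(1) mem by auto
    then show "j = i + row_length I i" using ij mem[of i j] by (fastforce simp: box_less_def)
    show "(k, j) \<notin> I" using ij(2)[of "(k, j)"] k by (auto simp: box_less_def)
  qed
  have inj: "inj_on ?f ?M"
  proof (rule inj_onI)
    fix x y assume xy: "x \<in> ?M" "y \<in> ?M" and eq: "?f x = ?f y"
    then have "fst x \<in> Domain I" "fst y \<in> Domain I" by (auto simp: Domain_fst)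
    then have "fst x = fst y" using inj_onD[OF inj_on_row_length[OF I] eq] by simp
    moreover have "snd x = fst x + row_length I (fst x)" "snd y = fst y + row_length I (fst y)"
      using corner(1)[of "fst x" "snd x" "Suc (fst x)"] corner(1)[of "fst y" "snd y" "Suc (fst y)"] xy by auto
    ultimately show "x = y" by (simp add: prod_eq_iff)
  qed
  have "?f ` ?M = ?S"
  proof (intro equalityI subsetI)
    fix s assume "s \<in> ?f ` ?M"
    then obtain i j where x: "(i, j) \<in> ?M" and s: "s = row_length I i" by force
    have j: "j = i + s" using corner(1)[OF x, of "Suc i"] s by simp
    have i: "i \<in> Domain I" using x by blast
    have "s - 1 \<notin> row_lengths I"
    proof
      assume "s - 1 \<in> row_lengths I"
      then obtain k where k: "k \<in> Domain I" "row_length I k = s - 1"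
        unfolding row_lengths_def by (metis imageE)
      have sk: "s - 1 > 0" using k pos by metis
      have "i < k"
      proof (rule ccontr)
        assume "\<not> i < k"
        moreover have "k \<noteq> i" using k(2) s sk by auto
        ultimately have "k < i" by simp
        then show False using row_length_decreasing[OF I Domain_box_ideal[OF I k(1)] _ i] k(2) s sk by auto
      qed
      then have "k = Suc i"
        using row_length_decreasing[OF I Domain_box_ideal[OF I i] _ k(1)] k(2) s sk by auto
      then have "(k, j) \<in> I" using k(2) sk j by (simp add: mem)
      then show False using corner(2)[OF x \<open>i < k\<close>] by blast
    qed
    then show "s \<in> ?S" using i s by (auto simp: row_lengths_def)
  next
    fix s assume "s \<in> ?S"
    then obtain i where i: "i \<in> Domain I" "s = row_length I i" and no: "s - 1 \<notin> row_lengths I"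
      by (auto simp: row_lengths_def)
    have s: "s > 0" using i pos by blast
    have "\<not> box_less (i, i + s) y" if y: "y \<in> I" for y
    proof
      assume less: "box_less (i, i + s) y"
      obtain k l where kl: "y = (k, l)" by fastforce
      then have "k \<noteq> i" using less y i(2) mem[of k l] by (auto simp: box_less_def)
      then have "l = i + s" "i < k" using less kl by (auto simp: box_less_def)
      have "k < l" using y kl mem by blast
      \<comment> \<open>A box lower in column i + s forces the one in row i + 1, so that row has
        length at least s - 1, while strict decrease allows no more.\<close>
      have "(Suc i, i + s) \<in> I"
        using box_ideal_down[OF I, of k l "Suc i" l] y kl \<open>l = i + s\<close> \<open>i < k\<close> \<open>k < l\<close> by auto
      then have "s - 1 \<le> row_length I (Suc i)" "Suc i \<in> Domain I" using mem[of "Suc i" "i + s"] by auto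
      moreover have "row_length I (Suc i) + 1 \<le> s"
        using row_length_decreasing[OF I Domain_box_ideal[OF I i(1)] lessI \<open>Suc i \<in> Domain I\<close>] i(2) by simp
      ultimately have "s - 1 \<in> row_lengths I" by (auto simp: row_lengths_def intro!: image_eqI[of _ _ "Suc i"])
      then show False using no by blast
    qed
    moreover have "(i, i + s) \<in> I" using i(2) s by (simp add: mem)
    ultimately show "s \<in> ?f ` ?M" using i(2) by (intro image_eqI[of _ _ "(i, i + s)"]) auto
  qed
  with inj show ?thesis by (simp add: bij_betw_def)
qed

lemma order_ideals_remove_maximal:
  "I \<in> order_ideals D R \<Longrightarrow> \<forall>y\<in>I. \<not> R x y \<Longrightarrow> I - {x} \<in> order_ideals D R"
  by (auto simp: order_ideals_def)

text \<open>The induction on the number of boxes removes the box with the largest entry;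
  \<open>bij_betw_corners\<close> turns the sum over removable boxes into the sum over lengths
  evaluated by \<open>schur_weight_rec\<close>.\<close>

lemma card_shifted_tableaux:
  assumes "I \<in> order_ideals (shifted_staircase n) box_less"
  shows "real (card (standard_tableaux I)) = fact (card I) * schur_weight (row_lengths I)"
  using assms unfolding standard_tableaux_eq_linear_extensions
proof (induction "card I" arbitrary: I)
  case 0
  then have "I = {}" using finite_box_ideal by fastforce
  moreover have "linear_extensions {} box_less = {\<lambda>_. undefined}"
    by (auto simp: linear_extensions_def bij_betw_def)
  ultimately show ?case by (simp add: row_lengths_def schur_weight_def)
next
  case (Suc m)
  let ?M = "{x \<in> I. \<forall>y\<in>I. \<not> box_less x y}" and ?S = "row_lengths I"
  let ?w = "\<lambda>s. schur_weight (insert (s - 1) (?S - {s}))"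
  have fin: "finite I" by (rule finite_box_ideal[OF Suc.prems])
  have "I \<noteq> {}" using Suc.hyps(2) by auto
  then have "real (card (linear_extensions I box_less)) =
      (\<Sum>x\<in>?M. real (card (linear_extensions (I - {x}) box_less)))"
    by (subst card_linear_extensions_rec[OF fin]) (simp_all add: box_less_def)
  also have "\<dots> = (\<Sum>x\<in>?M. fact m * ?w (row_length I (fst x)))"
  proof (rule sum.cong[OF refl])
    fix x assume x: "x \<in> ?M"
    have "I - {x} \<in> order_ideals (shifted_staircase n) box_less"
      using x order_ideals_remove_maximal[OF Suc.prems] by blast
    moreover have "card (I - {x}) = m" using x Suc.hyps(2) by simp
    moreover have "schur_weight (row_lengths (I - {x})) = ?w (row_length I (fst x))"
      using schur_weight_row_lengths_remove[OF Suc.prems, of "fst x" "snd x"] x by simp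
    ultimately show "real (card (linear_extensions (I - {x}) box_less)) = fact m * ?w (row_length I (fst x))"
      using Suc.hyps(1)[of "I - {x}"] by simp
  qed
  also have "\<dots> = (\<Sum>s | s \<in> ?S \<and> s - 1 \<notin> ?S. fact m * ?w s)"
    by (rule sum.reindex_bij_betw[OF bij_betw_corners[OF Suc.prems]])
  also have "\<dots> = fact m * (real (\<Sum>?S) * schur_weight ?S)"
  proof -
    have "finite ?S" using fin by (simp add: row_lengths_def finite_Domain)
    moreover have "0 \<notin> ?S" using row_length_pos_iff[OF fin] by (force simp: row_lengths_def)
    ultimately have "(\<Sum>s | s \<in> ?S \<and> s - 1 \<notin> ?S. ?w s) = real (\<Sum>?S) * schur_weight ?S"
      by (rule schur_weight_rec)
    then show ?thesis by (simp only: sum_distrib_left[symmetric])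
  qed
  also have "\<dots> = fact (card I) * schur_weight ?S"
    unfolding card_eq_sum_row_lengths[OF Suc.prems, symmetric] Suc.hyps(2)[symmetric] by simp
  finally show ?case .
qed

section \<open>The full staircase\<close>

lemma row_lengths_shifted_staircase: "row_lengths (shifted_staircase n) = {1..n - 1}"
proof -
  have "shifted_staircase n `` {i} = (if i = 0 then {} else {i<..n})" for i
    by (auto simp: shifted_staircase_def)
  then have len: "row_length (shifted_staircase n) i = (if i = 0 then 0 else n - i)" for i
    by (simp add: row_length_def)
  have dom: "Domain (shifted_staircase n) = {1..n - 1}"
  proof (intro equalityI subsetI)
    fix i assume "i \<in> {1..n - 1}"
    then have "(i, n) \<in> shifted_staircase n" by (auto simp: shifted_staircase_def)
    then show "i \<in> Domain (shifted_staircase n)" by blast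
  qed (auto simp: shifted_staircase_def)
  have "{1..n - 1} = (\<lambda>i. n - i) ` {1..n - 1}"
  proof (intro equalityI subsetI)
    fix i assume "i \<in> {1..n - 1}"
    then show "i \<in> (\<lambda>i. n - i) ` {1..n - 1}" by (intro image_eqI[of _ _ "n - i"]) auto
  qed auto
  moreover have "row_length (shifted_staircase n) ` {1..n - 1} = (\<lambda>i. n - i) ` {1..n - 1}"
    using len by (intro image_cong) auto
  ultimately show ?thesis unfolding row_lengths_def dom by simp
qed

theorem corollary5p5:
  fixes n :: nat
  assumes "n > 2"
  shows "card (maximal_chains_weak_unimodal n) = 2 * card (standard_tableaux (shifted_staircase n))
    \<and> real (card (maximal_chains_weak_unimodal n))
        = 2 * fact (n choose 2) * (\<Prod>i=0..n-2. fact i / fact (2 * i + 1))"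
proof
  show chains: "card (maximal_chains_weak_unimodal n) = 2 * card (standard_tableaux (shifted_staircase n))"
    by (rule card_maximal_chains[OF assms])
  have "shifted_staircase n \<in> order_ideals (shifted_staircase n) box_less" by (simp add: order_ideals_def)
  then have "real (card (standard_tableaux (shifted_staircase n))) =
      fact (n choose 2) * schur_weight {1..n - 1}"
    using card_shifted_tableaux by (simp add: card_shifted_staircase row_lengths_shifted_staircase)
  \<comment> \<open>The index range below n - 1 is rewritten as 0 to n - 2, which agrees because n
    is at least 2.\<close>
  also have "schur_weight {1..n - 1} = (\<Prod>i=0..n-2. fact i / fact (2 * i + 1))"
    unfolding schur_weight_staircase using assms by (intro prod.cong) auto
  finally show "real (card (maximal_chains_weak_unimodal n))
        = 2 * fact (n choose 2) * (\<Prod>i=0..n-2. fact i / fact (2 * i + 1))"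
    unfolding chains by simp
qed

end
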